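(* Let $M$ be a smooth compact manifold and let $g$ be a smooth non-degenerate symmetric bilinear form on $TM$. Then there exists an integer $m\in\mathbb{Z}_+$ such that $\mathfrak{L}_g^m=\mathcal{X}(M,\mathbb{R})$, that is, every smooth vector field on $M$ can be written as a linear combination of iterated Lie brackets of gradient vector fields (with respect to $g$) of depth at most $m$.
   Context: $\mathcal{X}(M,\mathbb{R})$ is the space of real smooth vector fields on $M$. $\mathbb{Z}_+=\{0,1,2,\dots\}$. The form $g$ is not assumed to be positive definite. For $f\in C^\infty(M,\mathbb{R})$, the gradient $\nabla_g f\in\mathcal{X}(M,\mathbb{R})$ is the vector field defined by $\mathrm{d}f_x(v)=g_x(\nabla_g f(x),v)$ for all $x\in M$ and $v\in T_xM$. Define $\mathfrak{L}_g^0:=\{\nabla_g f\mid f\in C^\infty(M,\mathbb{R})\}$, and for $m\ge 1$ let $\mathfrak{L}_g^m$ be the real linear span of $\{X+[\nabla_g f,Y]\mid f\in C^\infty(M,\mathbb{R}),\ X,Y\in\mathfrak{L}_g^{m-1}\}$; that is, $\mathfrak{L}_g^m$ is the real vector space spanned by iterated Lie brackets of depth at most $m$ of gradient vector fields. *)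

theory Defs
  imports "HOL-Analysis.Analysis"
begin

fun differentiable_times_on ::
    "nat \<Rightarrow> 'e::real_normed_vector set \<Rightarrow> ('e \<Rightarrow> 'b::real_normed_vector) \<Rightarrow> bool" where
  "differentiable_times_on 0 S f \<longleftrightarrow> continuous_on S f"
| "differentiable_times_on (Suc k) S f \<longleftrightarrow>
     (\<forall>x\<in>S. f differentiable (at x)) \<and>
     (\<forall>v. differentiable_times_on k S (\<lambda>x. frechet_derivative f (at x) v))"

text \<open>Used only for open \<open>S\<close> in a finite-dimensional space, where it is the usual notion of a
  \<open>C\<^sup>\<infinity>\<close> map: all iterated directional derivatives exist, are continuous and differentiable.\<close>

definition smooth_on :: "'e::real_normed_vector set \<Rightarrow> ('e \<Rightarrow> 'b::real_normed_vector) \<Rightarrow> bool" where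
  "smooth_on S f \<longleftrightarrow> (\<forall>k. differentiable_times_on k S f)"

text \<open>A chart is a pair of its domain and its coordinate map, which is only relevant on the domain.\<close>

type_synonym ('a, 'e) chart = "'a set \<times> ('a \<Rightarrow> 'e)"

text \<open>The points of the manifold are all points of the Hausdorff type \<open>'a\<close>; it has no boundary.
  The model space is a finite-dimensional inner product space, i.e. a copy of some \<open>\<real>\<^sup>n\<close>.  We do
  not use class \<open>euclidean_space\<close>, which would exclude \<open>n = 0\<close>.
  The atlas need not be maximal.  Second countability is not listed: the manifolds considered
  are compact, for which it is automatic.\<close>

definition smooth_atlas :: "('a::t2_space, 'e::real_inner) chart set \<Rightarrow> bool" where
  "smooth_atlas A \<longleftrightarrow>
     (\<exists>B::'e set. finite B \<and> span B = UNIV) \<and>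
     (\<Union>(U, \<phi>)\<in>A. U) = UNIV \<and>
     (\<forall>(U, \<phi>)\<in>A. open U \<and> open (\<phi> ` U) \<and> homeomorphism U (\<phi> ` U) \<phi> (inv_into U \<phi>)) \<and>
     (\<forall>(U, \<phi>)\<in>A. \<forall>(V, \<psi>)\<in>A. smooth_on (\<phi> ` (U \<inter> V)) (\<psi> \<circ> inv_into U \<phi>))"

definition smooth_functions :: "('a::t2_space, 'e::real_inner) chart set \<Rightarrow> ('a \<Rightarrow> real) set" where
  "smooth_functions A = {f. \<forall>(U, \<phi>)\<in>A. smooth_on (\<phi> ` U) (f \<circ> inv_into U \<phi>)}"

text \<open>Tangent vectors at \<open>x\<close> are the derivations at \<open>x\<close> of the algebra of smooth functions.
  They are set to \<open>0\<close> on non-smooth functions, so that equality of tangent vectors is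
  equality in HOL.  The differential is then \<open>df\<^sub>x(v) = v f\<close>.\<close>

type_synonym 'a tangent_vector = "('a \<Rightarrow> real) \<Rightarrow> real"

definition tangent_space ::
    "('a::t2_space, 'e::real_inner) chart set \<Rightarrow> 'a \<Rightarrow> 'a tangent_vector set" where
  "tangent_space A x = {v.
     (\<forall>f\<in>smooth_functions A. \<forall>h\<in>smooth_functions A. \<forall>a b.
        v (\<lambda>y. a * f y + b * h y) = a * v f + b * v h) \<and>
     (\<forall>f\<in>smooth_functions A. \<forall>h\<in>smooth_functions A.
        v (\<lambda>y. f y * h y) = f x * v h + h x * v f) \<and>
     (\<forall>f. f \<notin> smooth_functions A \<longrightarrow> v f = 0)}"

type_synonym 'a vector_field = "'a \<Rightarrow> 'a tangent_vector"

definition smooth_vector_fields ::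
    "('a::t2_space, 'e::real_inner) chart set \<Rightarrow> 'a vector_field set" where
  "smooth_vector_fields A = {X.
     (\<forall>x. X x \<in> tangent_space A x) \<and>
     (\<forall>f\<in>smooth_functions A. (\<lambda>x. X x f) \<in> smooth_functions A)}"

definition lie_bracket :: "'a vector_field \<Rightarrow> 'a vector_field \<Rightarrow> 'a vector_field" where
  "lie_bracket X Y = (\<lambda>x f. X x (\<lambda>y. Y y f) - Y x (\<lambda>y. X y f))"

text \<open>Smoothness of the tensor field \<open>g\<close> is tested on smooth vector fields.  Only the values of
  \<open>g x\<close> on the tangent space at \<open>x\<close> matter.\<close>

definition smooth_nondegenerate_form ::
    "('a::t2_space, 'e::real_inner) chart set \<Rightarrow>
     ('a \<Rightarrow> 'a tangent_vector \<Rightarrow> 'a tangent_vector \<Rightarrow> real) \<Rightarrow> bool" where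
  "smooth_nondegenerate_form A g \<longleftrightarrow>
     (\<forall>x. \<forall>u\<in>tangent_space A x. \<forall>v\<in>tangent_space A x. \<forall>w\<in>tangent_space A x. \<forall>a b.
        g x (\<lambda>f. a * u f + b * v f) w = a * g x u w + b * g x v w) \<and>
     (\<forall>x. \<forall>v\<in>tangent_space A x. \<forall>w\<in>tangent_space A x. g x v w = g x w v) \<and>
     (\<forall>x. \<forall>v\<in>tangent_space A x. (\<forall>w\<in>tangent_space A x. g x v w = 0) \<longrightarrow> v = (\<lambda>f. 0)) \<and>
     (\<forall>X\<in>smooth_vector_fields A. \<forall>Y\<in>smooth_vector_fields A.
        (\<lambda>x. g x (X x) (Y x)) \<in> smooth_functions A)"

definition gradient ::
    "('a::t2_space, 'e::real_inner) chart set \<Rightarrow>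
     ('a \<Rightarrow> 'a tangent_vector \<Rightarrow> 'a tangent_vector \<Rightarrow> real) \<Rightarrow> ('a \<Rightarrow> real) \<Rightarrow> 'a vector_field" where
  "gradient A g f = (\<lambda>x. THE w. w \<in> tangent_space A x \<and> (\<forall>v\<in>tangent_space A x. v f = g x w v))"

text \<open>Function types are not an instance of class \<open>real_vector\<close>, hence an explicit linear span.\<close>

definition real_span :: "'a vector_field set \<Rightarrow> 'a vector_field set" where
  "real_span S = {(\<lambda>x f. \<Sum>Z\<in>T. c Z * Z x f) | T c. finite T \<and> T \<subseteq> S}"

primrec gradient_brackets ::
    "('a::t2_space, 'e::real_inner) chart set \<Rightarrow>
     ('a \<Rightarrow> 'a tangent_vector \<Rightarrow> 'a tangent_vector \<Rightarrow> real) \<Rightarrow> nat \<Rightarrow> 'a vector_field set" where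
  "gradient_brackets A g 0 = {gradient A g f | f. f \<in> smooth_functions A}"
| "gradient_brackets A g (Suc m) = real_span
     {(\<lambda>x h. X x h + lie_bracket (gradient A g f) Y x h) | f X Y.
        f \<in> smooth_functions A \<and> X \<in> gradient_brackets A g m \<and> Y \<in> gradient_brackets A g m}"

end

(* Write F, H, K for the gradients of f, h, k.  Let T(P, Q, R) = g(P, Q) R + g(P, R) Q + g(Q, R) P.
   Since f F is the gradient of f^2 / 2, the combination [F, grad (f h)] - [grad (f^2 / 2), H] has
   depth one; by the Leibniz rule it equals T(F, F, H).  By polarisation all T(F, H, K)
   have depth at most one.  The Leibniz rule gives
     3 a T(F, H, K) = T(grad (a f), H, K) + T(grad (a h), F, K) + T(grad (a k), F, H)
       - 1/2 (T(grad a, grad (f h), K) + T(grad a, grad (f k), H) + T(grad a, grad (h k), F)),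
   so even a T(F, H, K) has depth at most one for every smooth a.  Locally each vector field is a
   combination of gradients with smooth coefficients, hence the same holds for all T(P, Q, R) with
   P, Q, R supported in a chart.  For s = g(Q, Q) we have s T(P, Q, Q) - 2/3 g(P, Q) T(Q, Q, Q) = s^2 P,
   and Q can be chosen with s nonzero at a given point because g is non-degenerate.  Compactness and
   a partition of unity show that m = 1 works. *)

theory Submission
  imports Defs "Jordan_Normal_Form.Determinant"
begin

section \<open>Calculus of smooth maps\<close>

text \<open>The obstacle is that the fields of depth at most one form only a real vector space: a
  cut-off multiple of a member need not be a member, so local results cannot be patched. What is
  needed is a submodule over the smooth functions inside this space, large enough to contain all
  fields. The bracket itself is not tensorial, but in the difference of brackets considered the
  terms \<open>f [F, H]\<close> cancel, and the rest, \<open>F(f) H + F(h) F + H(f) F\<close>,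
  contains no derivative of \<open>F\<close> or \<open>H\<close>. It is thus a value of a tensor,
  symmetric and trilinear over the smooth functions; all later algebra rests on these two
  properties.

  As \<open>g\<close> may be indefinite, \<open>g(Q, Q)\<close> has no definite sign. The weight
  that arises is its square, so weights from different charts add up without cancellation.

  Tangent vectors are derivations of the algebra of global functions. Coordinates and coordinate
  fields must therefore be cut off before use, and that derivations have coordinate expansions has
  to be proved; hence the bump functions and Hadamard's lemma.\<close>

lemma differentiable_times_on_cong:
  assumes "open S" "\<And>x. x \<in> S \<Longrightarrow> f x = g x" "differentiable_times_on k S f"
  shows "differentiable_times_on k S g"
  using assms(2,3)
proof (induction k arbitrary: f g)
  case 0
  then show ?case using continuous_on_cong[of S S f g] by simp
next
  case (Suc k)
  \<comment> \<open>The derivatives are taken in the whole space, so agreement on \<open>S\<close>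
    passes to them only because \<open>S\<close> is open.\<close>
  have "(g has_derivative frechet_derivative f (at x)) (at x)" if "x \<in> S" for x
    using Suc.prems that \<open>open S\<close>
    by (auto simp: frechet_derivative_works intro: has_derivative_transform_within_open)
  note g' = this
  have g: "g differentiable (at x)" "frechet_derivative g (at x) = frechet_derivative f (at x)"
    if "x \<in> S" for x
    using differentiableI[OF g'[OF that]] frechet_derivative_at[OF g'[OF that]] by simp_all
  show ?case
    using Suc.prems(2) g Suc.IH[where f = "\<lambda>x. frechet_derivative f (at x) v" for v] by simp
qed

lemma differentiable_times_on_subset:
  "differentiable_times_on k S f \<Longrightarrow> T \<subseteq> S \<Longrightarrow> differentiable_times_on k T f"
  by (induction k arbitrary: f) (auto intro: continuous_on_subset)

lemma differentiable_times_on_continuous: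
  assumes "differentiable_times_on k S f"
  shows "continuous_on S f"
proof (cases k)
  case (Suc n)
  then have "f differentiable (at x)" if "x \<in> S" for x using assms that by simp
  then show ?thesis
    by (intro continuous_at_imp_continuous_on ballI differentiable_imp_continuous_within)
qed (use assms in simp)

lemma differentiable_times_on_SucD:
  "differentiable_times_on (Suc k) S f \<Longrightarrow> differentiable_times_on k S f"
proof (induction k arbitrary: f)
  case 0
  show ?case using differentiable_times_on_continuous[OF 0] by simp
next
  case (Suc k)
  have "differentiable_times_on (Suc k) S (\<lambda>x. frechet_derivative f (at x) v)" for v
    using Suc.prems by simp
  then show ?case using Suc.IH Suc.prems by simp
qed

lemma differentiable_times_on_local:
  assumes "\<And>x. x \<in> S \<Longrightarrow> \<exists>N. open N \<and> x \<in> N \<and> differentiable_times_on k N f"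
  shows "differentiable_times_on k S f"
  using assms
proof (induction k arbitrary: f)
  case 0
  then show ?case
    by (auto intro!: continuous_at_imp_continuous_on) (metis continuous_on_eq_continuous_at)
next
  case (Suc k)
  have "\<exists>N. open N \<and> x \<in> N \<and> differentiable_times_on k N (\<lambda>x. frechet_derivative f (at x) v)"
    if "x \<in> S" for x v
    using Suc.prems[OF that] by auto
  moreover have "f differentiable (at x)" if "x \<in> S" for x
    using Suc.prems[OF that] by auto
  ultimately show ?case using Suc.IH by simp
qed

text \<open>The inductive proofs go through this rule: \<open>frechet_derivative\<close> is a
  choice, whereas the sum, product and chain rules deliver an explicit derivative
  \<open>f'\<close>.\<close>

lemma differentiable_times_on_SucI:
  assumes "open S" "\<And>x. x \<in> S \<Longrightarrow> (f has_derivative f' x) (at x)"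
    and "\<And>v. differentiable_times_on k S (\<lambda>x. f' x v)"
  shows "differentiable_times_on (Suc k) S f"
proof -
  have "frechet_derivative f (at x) = f' x" if "x \<in> S" for x
    using frechet_derivative_at[OF assms(2)[OF that]] by simp
  then have "differentiable_times_on k S (\<lambda>x. frechet_derivative f (at x) v)" for v
    using differentiable_times_on_cong[OF assms(1) _ assms(3)[of v]] by simp
  then show ?thesis using assms(2) by (auto simp: differentiable_def)
qed

lemma differentiable_times_on_SucE:
  assumes "differentiable_times_on (Suc k) S f"
  shows "\<And>x. x \<in> S \<Longrightarrow> (f has_derivative frechet_derivative f (at x)) (at x)"
    and "\<And>v. differentiable_times_on k S (\<lambda>x. frechet_derivative f (at x) v)"
  using assms by (auto simp: frechet_derivative_works)

lemma differentiable_times_on_const: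
  "open S \<Longrightarrow> differentiable_times_on k S (\<lambda>x. c)"
  by (induction k arbitrary: c) (simp, auto)

lemma differentiable_times_on_bounded_linear:
  assumes "open S" "bounded_linear L"
  shows "differentiable_times_on k S L"
proof (cases k)
  case 0
  then show ?thesis using assms(2) by (simp add: linear_continuous_on)
next
  case (Suc k)
  then show ?thesis
    using differentiable_times_on_SucI[OF assms(1) bounded_linear_imp_has_derivative[OF assms(2)]]
      differentiable_times_on_const[OF assms(1)] by blast
qed

lemma differentiable_times_on_add:
  assumes "open S" "differentiable_times_on k S f" "differentiable_times_on k S g"
  shows "differentiable_times_on k S (\<lambda>x. f x + g x)"
  using assms(2,3)
proof (induction k arbitrary: f g)
  case 0
  then show ?case by (simp add: continuous_on_add)
next
  case (Suc k)
  show ?case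
    by (rule differentiable_times_on_SucI[OF assms(1) has_derivative_add
          Suc.IH])
       (use Suc.prems in \<open>auto intro: differentiable_times_on_SucE\<close>)
qed

text \<open>The product rule gives a sum of two terms of the same bilinear shape, so the induction
  closes if \<open>f\<close> and \<open>g\<close> are left free. Multiplication, scaling and the
  inner product are all instances.\<close>

lemma differentiable_times_on_bilinear:
  assumes "bounded_bilinear p" "open S"
    "differentiable_times_on k S f" "differentiable_times_on k S g"
  shows "differentiable_times_on k S (\<lambda>x. p (f x) (g x))"
  using assms(3,4)
proof (induction k arbitrary: f g)
  case 0
  then show ?case using bounded_bilinear.continuous_on[OF assms(1)] by simp
next
  case (Suc k)
  show ?case
    by (rule differentiable_times_on_SucI[OF assms(2) bounded_bilinear.FDERIV[OF assms(1)]
          differentiable_times_on_add[OF assms(2) Suc.IH Suc.IH]])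
       (use Suc.prems in \<open>auto intro: differentiable_times_on_SucE differentiable_times_on_SucD\<close>)
qed

lemma differentiable_times_on_sum:
  assumes "open S" "\<And>i. i \<in> I \<Longrightarrow> differentiable_times_on k S (f i)"
  shows "differentiable_times_on k S (\<lambda>x. \<Sum>i\<in>I. f i x)"
proof (cases "finite I")
  case True
  then show ?thesis
    using assms(2)
    by (induction I) (auto intro!: differentiable_times_on_add differentiable_times_on_const assms(1))
qed (simp add: differentiable_times_on_const assms(1))

section \<open>Orthonormal bases, the chain rule and compactness of balls\<close>

locale orthonormal_basis =
  fixes B :: "'e::real_inner set"
  assumes finite_basis: "finite B"
    and inner_basis: "\<And>b c. b \<in> B \<Longrightarrow> c \<in> B \<Longrightarrow> inner b c = (if b = c then 1 else 0)"
    and basis_expansion: "\<And>x. (\<Sum>b\<in>B. inner x b *\<^sub>R b) = x"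
begin

lemma linear_expansion:
  assumes "linear f"
  shows "f x = (\<Sum>b\<in>B. inner x b *\<^sub>R f b)"
proof -
  have "f x = f (\<Sum>b\<in>B. inner x b *\<^sub>R b)" by (simp add: basis_expansion)
  also have "\<dots> = (\<Sum>b\<in>B. inner x b *\<^sub>R f b)"
    using assms by (simp add: linear_sum linear_scale)
  finally show ?thesis .
qed

text \<open>The chain rule applies the derivative of \<open>f\<close> to a direction that varies
  with the point, while the recursion controls derivatives only in fixed directions. Expanding the
  varying direction in the basis repairs this, which is why the middle space is the one with a
  finite basis.\<close>

lemma differentiable_times_on_compose:
  fixes f :: "'e \<Rightarrow> 'b::real_normed_vector" and g :: "'c::real_normed_vector \<Rightarrow> 'e"
  assumes "open S" "open T" "g ` S \<subseteq> T"
    "differentiable_times_on k T f" "differentiable_times_on k S g"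
  shows "differentiable_times_on k S (\<lambda>x. f (g x))"
  using assms(4,5)
proof (induction k arbitrary: f)
  case 0
  then show ?case using continuous_on_compose2 assms(3) by auto
next
  case (Suc k)
  have D: "((\<lambda>x. f (g x)) has_derivative
      (\<lambda>v. \<Sum>b\<in>B. inner (frechet_derivative g (at x) v) b *\<^sub>R frechet_derivative f (at (g x)) b)) (at x)"
    if "x \<in> S" for x
  proof -
    have "g x \<in> T" using that assms(3) by auto
    note df = differentiable_times_on_SucE(1)[OF Suc.prems(1) this]
    have "((\<lambda>x. f (g x)) has_derivative
        (\<lambda>v. frechet_derivative f (at (g x)) (frechet_derivative g (at x) v))) (at x)"
      using has_derivative_compose[OF differentiable_times_on_SucE(1)[OF Suc.prems(2) that] df] .
    moreover have "linear (frechet_derivative f (at (g x)))"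
      using df has_derivative_linear by blast
    ultimately show ?thesis by (simp add: linear_expansion[symmetric])
  qed
  show ?case
  proof (rule differentiable_times_on_SucI[OF assms(1) D], assumption)
    fix v
    have "differentiable_times_on k S (\<lambda>x. inner (frechet_derivative g (at x) v) b)" for b
      by (rule differentiable_times_on_bilinear[OF bounded_bilinear_inner assms(1)
            differentiable_times_on_SucE(2)[OF Suc.prems(2)] differentiable_times_on_const[OF assms(1)]])
    moreover have "differentiable_times_on k S (\<lambda>x. frechet_derivative f (at (g x)) b)" for b
      by (rule Suc.IH[OF differentiable_times_on_SucE(2)[OF Suc.prems(1)]
            differentiable_times_on_SucD[OF Suc.prems(2)]])
    ultimately show "differentiable_times_on k S (\<lambda>x. \<Sum>b\<in>B.
        inner (frechet_derivative g (at x) v) b *\<^sub>R frechet_derivative f (at (g x)) b)"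
      by (rule differentiable_times_on_sum[OF assms(1)
            differentiable_times_on_bilinear[OF bounded_bilinear_scaleR assms(1)]])
  qed
qed

lemma smooth_on_compose:
  fixes f :: "'e \<Rightarrow> 'b::real_normed_vector" and g :: "'c::real_normed_vector \<Rightarrow> 'e"
  shows "open S \<Longrightarrow> open T \<Longrightarrow> g ` S \<subseteq> T \<Longrightarrow> smooth_on T f \<Longrightarrow> smooth_on S g
    \<Longrightarrow> smooth_on S (\<lambda>x. f (g x))"
  unfolding smooth_on_def by (blast intro: differentiable_times_on_compose)

text \<open>Serves to compare two differentials in all directions when they are known to be close in
  the finitely many basis directions.\<close>

lemma norm_linear_le_basis:
  fixes f :: "'e \<Rightarrow> real"
  assumes "linear f" "\<And>b. b \<in> B \<Longrightarrow> \<bar>f b\<bar> \<le> e"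
  shows "\<bar>f x\<bar> \<le> real (card B) * e * norm x"
proof -
  have "\<bar>f x\<bar> \<le> (\<Sum>b\<in>B. \<bar>inner x b *\<^sub>R f b\<bar>)"
    by (subst linear_expansion[OF assms(1)]) (rule sum_abs)
  also have "\<dots> \<le> (\<Sum>b\<in>B. norm x * e)"
  proof (rule sum_mono)
    fix b assume b: "b \<in> B"
    have "\<bar>inner x b\<bar> \<le> norm x"
      using Cauchy_Schwarz_ineq2[of x b] inner_basis[OF b b] by (simp add: norm_eq_sqrt_inner)
    then show "\<bar>inner x b *\<^sub>R f b\<bar> \<le> norm x * e"
      using assms(2)[OF b] by (auto simp: abs_mult intro: mult_mono)
  qed
  finally show ?thesis by (simp add: mult_ac)
qed

text \<open>In orthonormal coordinates a ball around 0 lies in a cube, and the cube is a finite sum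
  of segments, hence compact by induction on the number of basis vectors.\<close>

lemma compact_cball: "compact (cball (p::'e) r)"
proof -
  define K where "K F = {(\<Sum>b\<in>F. c b *\<^sub>R b) | c. \<forall>b. \<bar>c b\<bar> \<le> r}" for F :: "'e set"
  have comp: "compact (K F)" if "finite F" for F
    using that
  proof induction
    case empty
    have "K {} \<subseteq> {0}" by (auto simp: K_def)
    then show ?case by (metis finite_subset finite.emptyI finite.insertI finite_imp_compact)
  next
    case (insert a F)
    have "K (insert a F) = {x + y | x y. x \<in> (\<lambda>t. t *\<^sub>R a) ` {-r..r} \<and> y \<in> K F}" (is "_ = ?R")
    proof (intro Set.set_eqI iffI)
      fix z assume "z \<in> K (insert a F)"
      then obtain c where c: "\<And>b. \<bar>c b\<bar> \<le> r" "z = (\<Sum>b\<in>insert a F. c b *\<^sub>R b)"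
        by (auto simp: K_def)
      have "c a *\<^sub>R a \<in> (\<lambda>t. t *\<^sub>R a) ` {-r..r}" "(\<Sum>b\<in>F. c b *\<^sub>R b) \<in> K F"
        using c(1) by (auto simp: K_def abs_le_iff intro!: imageI) (metis minus_le_iff)
      then show "z \<in> ?R" using c(2) insert.hyps by auto
    next
      fix z assume "z \<in> ?R"
      then obtain t c where t: "-r \<le> t" "t \<le> r" "\<And>b. \<bar>c b\<bar> \<le> r" "z = t *\<^sub>R a + (\<Sum>b\<in>F. c b *\<^sub>R b)"
        unfolding K_def by fastforce
      have "(\<Sum>b\<in>F. (c(a := t)) b *\<^sub>R b) = (\<Sum>b\<in>F. c b *\<^sub>R b)"
        using insert.hyps(2) by (intro sum.cong) auto
      then have "z = (\<Sum>b\<in>insert a F. (c(a := t)) b *\<^sub>R b)"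
        using t insert.hyps by simp
      moreover have "\<bar>(c(a := t)) b\<bar> \<le> r" for b using t by auto
      ultimately show "z \<in> K (insert a F)" unfolding K_def by blast
    qed
    moreover have "compact ((\<lambda>t. t *\<^sub>R a) ` {-r..r})"
      by (intro compact_continuous_image continuous_intros) simp
    ultimately show ?case using compact_sums insert.IH by simp
  qed
  have "cball 0 r \<subseteq> K B"
  proof
    fix x :: 'e assume "x \<in> cball 0 r"
    then have "\<bar>inner x b\<bar> \<le> r" if "b \<in> B" for b
      using Cauchy_Schwarz_ineq2[of x b] inner_basis[OF that that] by (simp add: norm_eq_sqrt_inner)
    \<comment> \<open>\<open>K\<close> bounds the coefficients on the whole type, so they are set to
      0 off \<open>B\<close>; this is where \<open>0 \<le> r\<close> enters.\<close>
    moreover have "(\<Sum>b\<in>B. (if b \<in> B then inner x b else 0) *\<^sub>R b) = x"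
      using basis_expansion[of x] by (simp cong: sum.cong)
    moreover have "0 \<le> r" using \<open>x \<in> cball 0 r\<close> norm_ge_zero[of x] by (simp del: norm_ge_zero)
    ultimately show "x \<in> K B"
      unfolding K_def by (intro CollectI exI[of _ "\<lambda>b. if b \<in> B then inner x b else 0"]) auto
  qed
  then have "compact (cball (0::'e) r)"
    using compact_Int_closed[OF comp[OF finite_basis] closed_cball] by (metis inf.absorb_iff2)
  then have "compact ((+) p ` cball 0 r)" by (rule compact_translation)
  then show ?thesis by (simp add: cball_translation)
qed

end

lemma obtain_orthonormal_basis:
  fixes S :: "'e::real_inner set"
  assumes "finite S" "span S = UNIV"
  obtains B :: "'e set" where "orthonormal_basis B"
proof -
  obtain C where C: "finite C" "span C = (UNIV::'e set)" "pairwise real_inner_class.orthogonal C"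
    using basis_orthogonal[OF assms(1)] assms(2) by auto
  \<comment> \<open>A pairwise orthogonal set may contain 0, which cannot be normalised.\<close>
  define B where "B = (\<lambda>c. c /\<^sub>R norm c) ` (C - {0})"
  have fin: "finite B" using C by (simp add: B_def)
  have on: "inner b c = (if b = c then 1 else 0)" if bc: "b \<in> B" "c \<in> B" for b c
  proof -
    have norm1: "\<exists>b'\<in>C. b' \<noteq> 0 \<and> b = b' /\<^sub>R norm b'" if "b \<in> B" for b
      using that by (auto simp: B_def)
    obtain b' c' where "b' \<in> C" "c' \<in> C" "b' \<noteq> 0" "c' \<noteq> 0" "b = b' /\<^sub>R norm b'" "c = c' /\<^sub>R norm c'"
      using norm1[OF bc(1)] norm1[OF bc(2)] by metis
    moreover have "inner b' c' = 0" if "b' \<noteq> c'"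
      using C(3) that \<open>b' \<in> C\<close> \<open>c' \<in> C\<close> by (auto simp: pairwise_def real_inner_class.orthogonal_def)
    ultimately have "inner b c = (if b' = c' then 1 else 0)" "inner b b = 1"
      by (auto simp: dot_square_norm power2_eq_square field_simps)
    then show ?thesis using \<open>b = b' /\<^sub>R norm b'\<close> \<open>c = c' /\<^sub>R norm c'\<close> by (metis zero_neq_one)
  qed
  have "C \<subseteq> span B"
  proof
    fix c assume "c \<in> C"
    show "c \<in> span B"
    proof (cases "c = 0")
      case False
      then have "c /\<^sub>R norm c \<in> B" using \<open>c \<in> C\<close> by (simp add: B_def)
      then have "norm c *\<^sub>R (c /\<^sub>R norm c) \<in> span B" by (intro span_scale span_base)
      then show ?thesis using False by simp
    qed (simp add: span_zero)
  qed
  then have "span B = UNIV" using C(2) span_minimal subspace_span by blast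
  have "(\<Sum>b\<in>B. inner x b *\<^sub>R b) = x" for x
  proof -
    have "x \<in> span B" using \<open>span B = UNIV\<close> by simp
    then show ?thesis
    proof (induction rule: span_induct_alt)
      case base
      then show ?case by simp
    next
      case (step c a y)
      have "(\<Sum>b\<in>B. inner a b *\<^sub>R b) = (\<Sum>b\<in>B. if b = a then b else 0)"
        using on step(1) by (intro sum.cong) auto
      then have "(\<Sum>b\<in>B. inner a b *\<^sub>R b) = a" using step(1) fin by simp
      moreover have "(\<Sum>b\<in>B. inner (c *\<^sub>R a + y) b *\<^sub>R b)
          = c *\<^sub>R (\<Sum>b\<in>B. inner a b *\<^sub>R b) + (\<Sum>b\<in>B. inner y b *\<^sub>R b)"
        by (simp add: inner_add_left scaleR_left_distrib sum.distrib scaleR_sum_right)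
      ultimately show ?case using step(2) by simp
    qed
  qed
  then show thesis using that[of B] fin on by (simp add: orthonormal_basis_def)
qed

section \<open>Closure properties of smooth maps\<close>

lemma smooth_on_cong:
  "open S \<Longrightarrow> (\<And>x. x \<in> S \<Longrightarrow> f x = g x) \<Longrightarrow> smooth_on S f \<Longrightarrow> smooth_on S g"
  unfolding smooth_on_def using differentiable_times_on_cong by blast

lemma smooth_on_subset: "smooth_on S f \<Longrightarrow> T \<subseteq> S \<Longrightarrow> smooth_on T f"
  unfolding smooth_on_def using differentiable_times_on_subset by blast

lemma smooth_on_local:
  "(\<And>x. x \<in> S \<Longrightarrow> \<exists>N. open N \<and> x \<in> N \<and> smooth_on N f) \<Longrightarrow> smooth_on S f"
  unfolding smooth_on_def by (meson differentiable_times_on_local)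

lemma smooth_on_const: "open S \<Longrightarrow> smooth_on S (\<lambda>x. c)"
  by (simp add: smooth_on_def differentiable_times_on_const)

lemma smooth_on_bounded_linear: "open S \<Longrightarrow> bounded_linear L \<Longrightarrow> smooth_on S L"
  by (simp add: smooth_on_def differentiable_times_on_bounded_linear)

lemma smooth_on_add:
  "open S \<Longrightarrow> smooth_on S f \<Longrightarrow> smooth_on S g \<Longrightarrow> smooth_on S (\<lambda>x. f x + g x)"
  by (simp add: smooth_on_def differentiable_times_on_add)

lemma smooth_on_bilinear:
  "bounded_bilinear p \<Longrightarrow> open S \<Longrightarrow> smooth_on S f \<Longrightarrow> smooth_on S g
    \<Longrightarrow> smooth_on S (\<lambda>x. p (f x) (g x))"
  by (simp add: smooth_on_def differentiable_times_on_bilinear)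

lemma smooth_on_mult:
  fixes f g :: "'e::real_normed_vector \<Rightarrow> real"
  shows "open S \<Longrightarrow> smooth_on S f \<Longrightarrow> smooth_on S g \<Longrightarrow> smooth_on S (\<lambda>x. f x * g x)"
  by (rule smooth_on_bilinear[OF bounded_bilinear_mult])

lemma smooth_on_imp_continuous_on: "smooth_on S f \<Longrightarrow> continuous_on S f"
  using differentiable_times_on.simps(1) unfolding smooth_on_def by blast

lemma smooth_on_has_derivative:
  assumes "smooth_on S f" "x \<in> S"
  shows "(f has_derivative frechet_derivative f (at x)) (at x)"
  using assms differentiable_times_on_SucE(1)[of 0] unfolding smooth_on_def by blast

lemma smooth_on_frechet_derivative:
  assumes "smooth_on S f"
  shows "smooth_on S (\<lambda>x. frechet_derivative f (at x) v)"
  using assms differentiable_times_on_SucE(2) unfolding smooth_on_def by blast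

lemma orthonormal_basis_real: "orthonormal_basis {1::real}"
  by standard auto

text \<open>The derivative of \<open>inverse\<close> is a constant times a product of two copies of
  \<open>inverse\<close>, so one order of differentiability yields the next.\<close>

lemma smooth_on_inverse_real: "smooth_on (- {0::real}) inverse"
  unfolding smooth_on_def
proof
  fix k show "differentiable_times_on k (- {0::real}) inverse"
  proof (induction k)
    case 0
    show ?case by (auto intro!: continuous_intros)
  next
    case (Suc k)
    have "(inverse has_derivative (\<lambda>v. - (inverse x * v * inverse x))) (at x)" if "x \<in> - {0}" for x :: real
      using that by (auto intro: has_derivative_inverse')
    moreover have "differentiable_times_on k (- {0::real}) (\<lambda>x. - (inverse x * v * inverse x))" for v
    proof -
      have "differentiable_times_on k (- {0::real}) (\<lambda>x. (- v) * (inverse x * inverse x))"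
        by (intro differentiable_times_on_bilinear[OF bounded_bilinear_mult]
            differentiable_times_on_const Suc.IH) auto
      then show ?thesis by (simp add: mult_ac)
    qed
    ultimately show ?case by (intro differentiable_times_on_SucI) auto
  qed
qed

lemma smooth_on_inverse:
  fixes f :: "'e::real_normed_vector \<Rightarrow> real"
  assumes "open S" "smooth_on S f" "\<And>x. x \<in> S \<Longrightarrow> f x \<noteq> 0"
  shows "smooth_on S (\<lambda>x. inverse (f x))"
  using orthonormal_basis.smooth_on_compose[OF orthonormal_basis_real assms(1) _ _ smooth_on_inverse_real
      assms(2)] assms(3) by fastforce

section \<open>Bump functions and Hadamard's lemma\<close>

text \<open>The powers of \<open>1/t\<close> make the family closed under differentiation: the
  derivative of member \<open>n\<close> combines members \<open>n + 1\<close> and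
  \<open>n + 2\<close>. Smoothness of \<open>exp (-1/t)\<close> alone would give no
  induction.\<close>

definition exp_flat :: "nat \<Rightarrow> real \<Rightarrow> real" where
  "exp_flat n t = (if t > 0 then inverse t ^ n * exp (- inverse t) else 0)"

lemma power_le_fact_exp:
  assumes "(u::real) \<ge> 0"
  shows "u ^ m \<le> fact m * exp u"
proof -
  have "(\<Sum>n\<in>{m}. u ^ n /\<^sub>R fact n) \<le> (\<Sum>n. u ^ n /\<^sub>R fact n)"
    using assms summable_exp_generic[of u] by (intro sum_le_suminf) auto
  then show ?thesis by (simp add: exp_def field_simps)
qed

text \<open>With \<open>u = 1/t\<close> the exponential beats \<open>u ^ (n + 2)\<close>. The two
  surplus powers become the factor \<open>t\<^sup>2\<close>, which forces value and derivative at 0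
  to vanish.\<close>

lemma exp_flat_bound: "\<bar>exp_flat n t\<bar> \<le> fact (n + 2) * t\<^sup>2"
proof (cases "t > 0")
  case True
  have "inverse t ^ (n + 2) * exp (- inverse t) \<le> fact (n + 2)"
    using power_le_fact_exp[of "inverse t" "n + 2"] True by (simp add: exp_minus field_simps)
  then have "inverse t ^ (n + 2) * exp (- inverse t) * t\<^sup>2 \<le> fact (n + 2) * t\<^sup>2"
    by (intro mult_right_mono) auto
  then show ?thesis using True by (simp add: exp_flat_def power_add power2_eq_square field_simps)
qed (simp add: exp_flat_def)

lemma exp_flat_has_derivative:
  "(exp_flat n has_derivative (\<lambda>v. v * (exp_flat (n + 2) t - real n * exp_flat (n + 1) t))) (at t)"
proof -
  consider "t > 0" | "t < 0" | "t = 0" by linarith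
  then show ?thesis
  proof cases
    case 1
    have "((\<lambda>t. inverse t ^ n * exp (- inverse t)) has_real_derivative
        exp_flat (n + 2) t - real n * exp_flat (n + 1) t) (at t)"
      using 1 by (auto intro!: derivative_eq_intros simp: exp_flat_def)
        (cases n; simp add: algebra_simps power2_eq_square)
    then have "((\<lambda>t. inverse t ^ n * exp (- inverse t)) has_derivative
        (\<lambda>v. v * (exp_flat (n + 2) t - real n * exp_flat (n + 1) t))) (at t)"
      unfolding has_field_derivative_def by (rule has_derivative_eq_rhs) (simp add: fun_eq_iff)
    then show ?thesis
      by (rule has_derivative_transform_within_open[where s = "{0<..}"]) (use 1 in \<open>auto simp: exp_flat_def\<close>)
  next
    case 2
    have "((\<lambda>t. 0) has_derivative (\<lambda>v. v * (exp_flat (n + 2) t - real n * exp_flat (n + 1) t))) (at t)"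
      using 2 by (simp add: exp_flat_def)
    then show ?thesis
      by (rule has_derivative_transform_within_open[where s = "{..<0}"]) (use 2 in \<open>auto simp: exp_flat_def\<close>)
  next
    case 3
    have "(exp_flat n has_derivative (\<lambda>v. 0)) (at 0)"
      unfolding has_derivative_at_alt
    proof (intro conjI allI impI)
      fix e :: real assume "e > 0"
      \<comment> \<open>For \<open>|y| < d\<close> the quadratic bound
        \<open>fact (n + 2) * y\<^sup>2\<close> is at most \<open>e * |y|\<close>.\<close>
      define d where "d = e / fact (n + 2)"
      have "norm (exp_flat n y - exp_flat n 0 - 0) \<le> e * norm (y - 0)" if "norm (y - 0) < d" for y
      proof -
        have "\<bar>exp_flat n y\<bar> \<le> (fact (n + 2) * \<bar>y\<bar>) * \<bar>y\<bar>"
          using exp_flat_bound[of n y] by (simp add: power2_eq_square abs_mult_self_eq mult.assoc)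
        also have "\<dots> \<le> e * \<bar>y\<bar>"
        proof (rule mult_right_mono)
          have "fact (n + 2) * \<bar>y\<bar> \<le> fact (n + 2) * d" using that by (intro mult_left_mono) auto
          then show "fact (n + 2) * \<bar>y\<bar> \<le> e" by (simp add: d_def del: fact_Suc add_2_eq_Suc')
        qed simp
        finally show ?thesis by (simp add: exp_flat_def)
      qed
      moreover have "d > 0" using \<open>e > 0\<close> by (simp add: d_def del: fact_Suc)
      ultimately show "\<exists>d>0. \<forall>y. norm (y - 0) < d \<longrightarrow>
          norm (exp_flat n y - exp_flat n 0 - 0) \<le> e * norm (y - 0)" by blast
    qed simp
    then show ?thesis using 3 by (simp add: exp_flat_def)
  qed
qed

lemma smooth_on_exp_flat: "smooth_on UNIV (exp_flat n)"
  unfolding smooth_on_def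
proof
  fix k show "differentiable_times_on k UNIV (exp_flat n)"
  proof (induction k arbitrary: n)
    case 0
    show ?case
      using has_derivative_continuous[OF exp_flat_has_derivative]
      by (auto intro!: continuous_at_imp_continuous_on)
  next
    case (Suc k)
    have "differentiable_times_on k UNIV (\<lambda>t. v * (exp_flat (n + 2) t + (- real n) * exp_flat (n + 1) t))"
      for v
      by (intro differentiable_times_on_bilinear[OF bounded_bilinear_mult] differentiable_times_on_add
          differentiable_times_on_const Suc.IH open_UNIV)
    then show ?case
      by (intro differentiable_times_on_SucI[OF _ exp_flat_has_derivative]) simp_all
  qed
qed

text \<open>The function is \<open>F(R\<^sup>2 - q) / (F(R\<^sup>2 - q) + F(q - r\<^sup>2))\<close>
  with \<open>F(t) = exp (-1/t)\<close> for \<open>t > 0\<close> and \<open>0\<close> otherwise.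
  Taking \<open>q\<close> as the squared distance keeps it smooth at the centre;
  \<open>r < R\<close> excludes that both arguments are non-positive, so the denominator is
  positive.\<close>

lemma bump_function_exists:
  fixes p :: "'e::real_inner"
  assumes "0 < r" "r < R"
  obtains s :: "'e \<Rightarrow> real" where "smooth_on UNIV s"
    "\<And>x. 0 \<le> s x" "\<And>x. s x \<le> 1" "\<And>x. x \<in> cball p r \<Longrightarrow> s x = 1" "\<And>x. x \<notin> ball p R \<Longrightarrow> s x = 0"
proof -
  define q where "q x = inner (x - p) (x - p)" for x
  define F where "F = exp_flat 0"
  have F: "F t \<ge> 0" "F t > 0 \<longleftrightarrow> t > 0" "F t = 0 \<longleftrightarrow> t \<le> 0" for t by (auto simp: F_def exp_flat_def)
  have "smooth_on UNIV (\<lambda>x. x + - p)"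
    by (intro smooth_on_add smooth_on_const smooth_on_bounded_linear bounded_linear_ident open_UNIV)
  then have q: "smooth_on UNIV q"
    unfolding q_def by (intro smooth_on_bilinear[OF bounded_bilinear_inner]) simp_all
  have aff: "smooth_on UNIV (\<lambda>x. F (c * q x + d))" for c d
    unfolding F_def
    by (rule orthonormal_basis.smooth_on_compose[OF orthonormal_basis_real _ _ _ smooth_on_exp_flat])
       (auto intro!: smooth_on_add smooth_on_mult smooth_on_const q)
  have r2: "r\<^sup>2 < R\<^sup>2" using assms by (simp add: power_strict_mono)
  \<comment> \<open>The arguments are spelled as \<open>c * q x + d\<close> to fit
    \<open>aff\<close>.\<close>
  define s where "s x = F (- 1 * q x + R\<^sup>2) * inverse (F (- 1 * q x + R\<^sup>2) + F (1 * q x + - r\<^sup>2))" for x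
  have pos: "F (- 1 * q x + R\<^sup>2) + F (1 * q x + - r\<^sup>2) > 0" for x
  proof (cases "q x < R\<^sup>2")
    case True
    then have "F (- 1 * q x + R\<^sup>2) > 0" by (simp add: F)
    then show ?thesis using F(1)[of "1 * q x + - r\<^sup>2"] by linarith
  next
    case False
    then have "F (1 * q x + - r\<^sup>2) > 0" using r2 by (simp add: F)
    then show ?thesis using F(1)[of "- 1 * q x + R\<^sup>2"] by linarith
  qed
  have sm: "smooth_on UNIV s"
    unfolding s_def using pos by (intro smooth_on_mult smooth_on_inverse smooth_on_add aff open_UNIV) (metis less_irrefl)
  have s01: "0 \<le> s x" "s x \<le> 1" for x
    using pos[of x] F(1)[of "- 1 * q x + R\<^sup>2"] F(1)[of "1 * q x + - r\<^sup>2"]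
    by (auto simp: s_def field_simps)
  have q_dist: "q x = (dist p x)\<^sup>2" for x
    by (simp add: q_def dot_square_norm dist_norm norm_minus_commute)
  have s1: "s x = 1" if "x \<in> cball p r" for x
  proof -
    have "q x \<le> r\<^sup>2" using that assms by (simp add: q_dist power_mono)
    then have "F (1 * q x + - r\<^sup>2) = 0" by (simp add: F)
    then show ?thesis using pos[of x] by (simp add: s_def)
  qed
  have s0: "s x = 0" if "x \<notin> ball p R" for x
  proof -
    have "R\<^sup>2 \<le> q x" using that assms by (simp add: q_dist power_mono)
    then show ?thesis by (simp add: s_def F)
  qed
  from that[of s] sm s01 s1 s0 show thesis by blast
qed

section \<open>Integrals along rays and Hadamard's lemma\<close>

context orthonormal_basis
begin

text \<open>The weight \<open>t ^ j\<close> is there for differentiation in \<open>z\<close>: by the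
  chain rule each derivative contributes one factor \<open>t\<close>.\<close>

definition ray_integral :: "'e \<Rightarrow> nat \<Rightarrow> ('e \<Rightarrow> real) \<Rightarrow> 'e \<Rightarrow> real" where
  "ray_integral q j H z = integral {0..1} (\<lambda>t. t ^ j * H (q + t *\<^sub>R (z - q)))"

lemma ray_mem:
  assumes "convex S" "q \<in> S" "z \<in> S" "0 \<le> t" "t \<le> 1"
  shows "q + t *\<^sub>R (z - q) \<in> S"
  using convexD_alt[OF assms] by (simp add: algebra_simps)

lemma continuous_on_ray:
  fixes q z :: 'e and H :: "'e \<Rightarrow> real"
  assumes "convex S" "q \<in> S" "z \<in> S" "continuous_on S H"
  shows "continuous_on {0..1} (\<lambda>t. t ^ j * H (q + t *\<^sub>R (z - q)))"
proof -
  have "continuous_on {0..1} (\<lambda>t. q + t *\<^sub>R (z - q))" by (intro continuous_intros)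
  then have "continuous_on {0..1} (\<lambda>t. H (q + t *\<^sub>R (z - q)))"
    by (rule continuous_on_compose2[OF assms(4)]) (use ray_mem[OF assms(1-3)] in auto)
  then show ?thesis by (intro continuous_intros)
qed

text \<open>Differentiation under the integral sign. For each \<open>t\<close> the mean value
  theorem bounds the remainder of the integrand; the bound is uniform in \<open>t\<close> because
  the partial derivatives are continuous and \<open>[0, 1]\<close> is compact.\<close>

lemma ray_integral_has_derivative:
  assumes S: "open S" "convex S" "q \<in> S" and H: "smooth_on S H" and z: "z \<in> S"
  shows "(ray_integral q j H has_derivative
    (\<lambda>v. \<Sum>b\<in>B. inner v b * ray_integral q (Suc j) (\<lambda>x. frechet_derivative H (at x) b) z)) (at z)"
  unfolding has_derivative_at_alt
proof (intro conjI allI impI)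
  show "bounded_linear (\<lambda>v. \<Sum>b\<in>B. inner v b *
      ray_integral q (Suc j) (\<lambda>x. frechet_derivative H (at x) b) z)"
    by (intro bounded_linear_sum bounded_linear_mult_const bounded_linear_inner_left)
next
  fix e :: real assume "e > 0"
  define D where "D x = frechet_derivative H (at x)" for x
  have D: "(H has_derivative D x) (at x)" if "x \<in> S" for x
    unfolding D_def using smooth_on_has_derivative[OF H that] .
  have contD: "continuous_on S (\<lambda>x. D x b)" for b
    unfolding D_def by (intro smooth_on_imp_continuous_on smooth_on_frechet_derivative H)
  have contH: "continuous_on S H" by (intro smooth_on_imp_continuous_on H)
  \<comment> \<open>Small enough for the sum over \<open>B\<close> to stay below \<open>e\<close>;
    adding 1 avoids division by 0 for the empty basis.\<close>
  define e' where "e' = e / (real (card B) + 1)"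
  have e': "e' > 0" "real (card B) * e' \<le> e" using \<open>e > 0\<close> by (auto simp: e'_def field_simps)
  \<comment> \<open>Compactness of \<open>[0, 1]\<close> gives one neighbourhood of \<open>z\<close>
    that serves all \<open>t\<close>.\<close>
  have "\<exists>X. open X \<and> z \<in> X \<and> (\<forall>y\<in>X \<inter> S. \<forall>t\<in>{0..1}.
      \<bar>D (q + t *\<^sub>R (y - q)) b - D (q + t *\<^sub>R (z - q)) b\<bar> \<le> e')" for b
  proof -
    have "continuous_on (S \<times> {0..1}) (\<lambda>w. D (q + snd w *\<^sub>R (fst w - q)) b)"
      by (intro continuous_intros continuous_on_compose2[OF contD])
         (use ray_mem[OF S(2,3)] in auto)
    from continuous_on_prod_compactE[OF this compact_Icc z e'(1)]
    obtain X where "z \<in> X" "open X" "\<forall>y\<in>X \<inter> S. \<forall>t\<in>{0..1::real}.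
        dist (D (q + t *\<^sub>R (y - q)) b) (D (q + t *\<^sub>R (z - q)) b) \<le> e'"
      by auto
    then show ?thesis by (auto simp: dist_real_def)
  qed
  then obtain X where X: "\<And>b. open (X b)" "\<And>b. z \<in> X b" "\<And>b y t. y \<in> X b \<Longrightarrow> y \<in> S \<Longrightarrow> t \<in> {0..1} \<Longrightarrow>
      \<bar>D (q + t *\<^sub>R (y - q)) b - D (q + t *\<^sub>R (z - q)) b\<bar> \<le> e'"
    by (metis IntI)
  have "open ((\<Inter>b\<in>B. X b) \<inter> S)" "z \<in> (\<Inter>b\<in>B. X b) \<inter> S"
    using X(1,2) finite_basis S(1) z by auto
  then obtain d where d: "d > 0" "ball z d \<subseteq> (\<Inter>b\<in>B. X b) \<inter> S"
    using open_contains_ball by metis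
  have "norm (ray_integral q j H y - ray_integral q j H z -
      (\<Sum>b\<in>B. inner (y - z) b * ray_integral q (Suc j) (\<lambda>x. D x b) z)) \<le> e * norm (y - z)"
    if y: "norm (y - z) < d" for y
  proof -
    have yS: "y \<in> S" using y d by (auto simp: dist_norm norm_minus_commute)
    have lin: "linear (D x)" if "x \<in> S" for x using D[OF that] has_derivative_linear by blast
    have zt: "q + t *\<^sub>R (z - q) \<in> S" if "t \<in> {0..1}" for t using ray_mem[OF S(2,3) z] that by simp
    have "(\<Sum>b\<in>B. inner (y - z) b * ray_integral q (Suc j) (\<lambda>x. D x b) z)
        = (\<Sum>b\<in>B. integral {0..1} (\<lambda>t. inner (y - z) b * (t ^ Suc j * D (q + t *\<^sub>R (z - q)) b)))"
      unfolding ray_integral_def by simp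
    also have "\<dots> = integral {0..1} (\<lambda>t. \<Sum>b\<in>B. inner (y - z) b * (t ^ Suc j * D (q + t *\<^sub>R (z - q)) b))"
      by (intro integral_sum[symmetric] finite_basis integrable_continuous_interval continuous_on_mult_left
          continuous_on_ray[OF S(2,3) z contD])
    \<comment> \<open>One of the factors \<open>t\<close> moves into the direction: when
      \<open>z\<close> moves to \<open>y\<close>, the ray point at \<open>t\<close> moves by
      \<open>t (y - z)\<close>.\<close>
    also have "\<dots> = integral {0..1} (\<lambda>t. t ^ j * D (q + t *\<^sub>R (z - q)) (t *\<^sub>R (y - z)))"
    proof (rule integral_cong)
      fix t :: real assume t: "t \<in> {0..1}"
      show "(\<Sum>b\<in>B. inner (y - z) b * (t ^ Suc j * D (q + t *\<^sub>R (z - q)) b))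
          = t ^ j * D (q + t *\<^sub>R (z - q)) (t *\<^sub>R (y - z))"
        by (subst linear_expansion[OF lin[OF zt[OF t]], of "t *\<^sub>R (y - z)"])
           (simp add: sum_distrib_left algebra_simps)
    qed
    finally have eq1: "(\<Sum>b\<in>B. inner (y - z) b * ray_integral q (Suc j) (\<lambda>x. D x b) z)
      = integral {0..1} (\<lambda>t. t ^ j * D (q + t *\<^sub>R (z - q)) (t *\<^sub>R (y - z)))" .
    have cont1: "continuous_on {0..1} (\<lambda>t. t ^ j * D (q + t *\<^sub>R (z - q)) (t *\<^sub>R (y - z)))"
    proof (rule continuous_on_eq)
      show "continuous_on {0..1} (\<lambda>t. \<Sum>b\<in>B. inner (y - z) b * (t ^ Suc j * D (q + t *\<^sub>R (z - q)) b))"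
        by (intro continuous_on_sum continuous_on_mult_left continuous_on_ray[OF S(2,3) z contD])
      fix t :: real assume t: "t \<in> {0..1}"
      show "(\<Sum>b\<in>B. inner (y - z) b * (t ^ Suc j * D (q + t *\<^sub>R (z - q)) b))
          = t ^ j * D (q + t *\<^sub>R (z - q)) (t *\<^sub>R (y - z))"
        by (subst linear_expansion[OF lin[OF zt[OF t]], of "t *\<^sub>R (y - z)"])
           (simp add: sum_distrib_left algebra_simps)
    qed
    note cont = continuous_on_ray[OF S(2,3) yS contH, of j] continuous_on_ray[OF S(2,3) z contH, of j] cont1
    have eq2: "ray_integral q j H y - ray_integral q j H z -
        (\<Sum>b\<in>B. inner (y - z) b * ray_integral q (Suc j) (\<lambda>x. D x b) z)
      = integral {0..1} (\<lambda>t. t ^ j * H (q + t *\<^sub>R (y - q)) - t ^ j * H (q + t *\<^sub>R (z - q))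
          - t ^ j * D (q + t *\<^sub>R (z - q)) (t *\<^sub>R (y - z)))"
      unfolding eq1 unfolding ray_integral_def
      using cont[THEN integrable_continuous_interval] by (simp add: integral_diff integrable_diff)
    have bd: "norm (t ^ j * H (q + t *\<^sub>R (y - q)) - t ^ j * H (q + t *\<^sub>R (z - q))
          - t ^ j * D (q + t *\<^sub>R (z - q)) (t *\<^sub>R (y - z))) \<le> e * norm (y - z)" if t: "t \<in> {0..1}" for t
    proof -
      \<comment> \<open>For fixed \<open>t\<close>, \<open>w\<close> runs from the ray point of
        \<open>z\<close> to that of \<open>y\<close>; the mean value theorem is applied to
        \<open>H\<close> along it.\<close>
      define w where "w s = q + t *\<^sub>R ((z + s *\<^sub>R (y - z)) - q)" for s
      have wb: "z + s *\<^sub>R (y - z) \<in> ball z d" if "s \<in> {0..1}" for s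
      proof -
        have "norm (s *\<^sub>R (y - z)) \<le> 1 * norm (y - z)" using that mult_right_mono[of s 1 "norm (y - z)"] by simp
        then show ?thesis using y by (simp add: dist_norm)
      qed
      then have wS: "w s \<in> S" if "s \<in> {0..1}" for s
        unfolding w_def using subsetD[OF d(2) wb[OF that]] t by (intro ray_mem[OF S(2,3)]) auto
      have w': "(w has_derivative (\<lambda>h. t *\<^sub>R (h *\<^sub>R (y - z)))) (at s within {0..1})" for s
        unfolding w_def by (auto intro!: derivative_eq_intros)
      have "\<exists>s\<in>{0..1}. (\<lambda>s. H (w s)) 1 - (\<lambda>s. H (w s)) 0 = (\<lambda>h. D (w s) (t *\<^sub>R (h *\<^sub>R (y - z)))) (1 - 0)"
        by (rule mvt_very_simple[OF _ has_derivative_compose[OF w' D[OF wS]]]) auto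
      then obtain s where s: "s \<in> {0..1}" "H (w 1) - H (w 0) = D (w s) (t *\<^sub>R (y - z))" by auto
      have "\<bar>(\<lambda>v. D (w s) v - D (w 0) v) (t *\<^sub>R (y - z))\<bar> \<le> real (card B) * e' * norm (t *\<^sub>R (y - z))"
      proof (rule norm_linear_le_basis)
        show "linear (\<lambda>v. D (w s) v - D (w 0) v)"
          using lin[OF wS] s(1) by (intro linear_compose_sub) auto
        fix b assume "b \<in> B"
        then show "\<bar>D (w s) b - D (w 0) b\<bar> \<le> e'"
          using X(3)[of "z + s *\<^sub>R (y - z)" b t] subsetD[OF d(2) wb[OF s(1)]] t by (auto simp: w_def)
      qed
      also have "\<dots> \<le> e * norm (t *\<^sub>R (y - z))" using e'(2) by (intro mult_right_mono) auto
      also have "\<dots> \<le> e * norm (y - z)"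
        using t \<open>e > 0\<close> by (intro mult_left_mono) (auto intro: mult_left_le_one_le)
      finally have "\<bar>H (w 1) - H (w 0) - D (w 0) (t *\<^sub>R (y - z))\<bar> \<le> e * norm (y - z)" using s(2) by simp
      moreover have "t ^ j \<le> 1" "0 \<le> t ^ j" using t by (auto intro: power_le_one)
      ultimately have "t ^ j * \<bar>H (w 1) - H (w 0) - D (w 0) (t *\<^sub>R (y - z))\<bar> \<le> 1 * (e * norm (y - z))"
        by (intro mult_mono) auto
      moreover have "t ^ j * H (q + t *\<^sub>R (y - q)) - t ^ j * H (q + t *\<^sub>R (z - q))
          - t ^ j * D (q + t *\<^sub>R (z - q)) (t *\<^sub>R (y - z))
          = t ^ j * (H (w 1) - H (w 0) - D (w 0) (t *\<^sub>R (y - z)))"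
        by (simp add: w_def algebra_simps)
      ultimately show ?thesis using \<open>0 \<le> t ^ j\<close> by (simp add: abs_mult)
    qed
    have "norm (integral {0..1} (\<lambda>t. t ^ j * H (q + t *\<^sub>R (y - q)) - t ^ j * H (q + t *\<^sub>R (z - q))
          - t ^ j * D (q + t *\<^sub>R (z - q)) (t *\<^sub>R (y - z)))) \<le> e * norm (y - z) * (1 - 0)"
      by (rule integral_bound[OF _ _ bd]) (use cont in \<open>auto intro: continuous_on_diff\<close>)
    then show ?thesis unfolding eq2 by simp
  qed
  with d(1) show "\<exists>d>0. \<forall>y. norm (y - z) < d \<longrightarrow> norm (ray_integral q j H y - ray_integral q j H z -
      (\<Sum>b\<in>B. inner (y - z) b * ray_integral q (Suc j) (\<lambda>x. frechet_derivative H (at x) b) z))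
      \<le> e * norm (y - z)"
    unfolding D_def by blast
qed

text \<open>Derivatives of ray integrals are sums of ray integrals of partial derivatives of
  \<open>H\<close> with exponent \<open>Suc j\<close>, so the induction leaves \<open>j\<close> and
  \<open>H\<close> free.\<close>

lemma smooth_on_ray_integral:
  assumes S: "open S" "convex S" "q \<in> S" and H: "smooth_on S H"
  shows "smooth_on S (ray_integral q j H)"
  unfolding smooth_on_def
proof
  fix k show "differentiable_times_on k S (ray_integral q j H)"
    using H
  proof (induction k arbitrary: j H)
    case 0
    then show ?case
      using has_derivative_continuous[OF ray_integral_has_derivative[OF S 0]]
      by (auto intro!: continuous_at_imp_continuous_on)
  next
    case (Suc k)
    show ?case
      by (rule differentiable_times_on_SucI[OF S(1) ray_integral_has_derivative[OF S Suc.prems]], assumption)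
         (intro differentiable_times_on_sum S(1) differentiable_times_on_bilinear[OF bounded_bilinear_mult]
           differentiable_times_on_const Suc.IH smooth_on_frechet_derivative Suc.prems)
  qed
qed

text \<open>\<open>G b z\<close> averages the partial derivative in direction \<open>b\<close> over
  the segment from \<open>q\<close> to \<open>z\<close>, and the fundamental theorem of calculus
  along the segment gives the formula. A derivation at \<open>q\<close> then sees only the values
  \<open>G b q\<close>.\<close>

lemma hadamard:
  assumes S: "open S" "convex S" "q \<in> S" and H: "smooth_on S H"
  obtains G where "\<And>b. smooth_on S (G b)" "\<And>b. G b q = frechet_derivative H (at q) b"
    "\<And>z. z \<in> S \<Longrightarrow> H z = H q + (\<Sum>b\<in>B. inner (z - q) b * G b z)"
proof -
  define G where "G b = ray_integral q 0 (\<lambda>x. frechet_derivative H (at x) b)" for b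
  have sm: "smooth_on S (G b)" for b
    unfolding G_def by (intro smooth_on_ray_integral S smooth_on_frechet_derivative H)
  have at_q: "G b q = frechet_derivative H (at q) b" for b by (simp add: G_def ray_integral_def)
  have "H z = H q + (\<Sum>b\<in>B. inner (z - q) b * G b z)" if z: "z \<in> S" for z
  proof -
    define w where "w t = q + t *\<^sub>R (z - q)" for t
    have wS: "w t \<in> S" if "t \<in> {0..1}" for t unfolding w_def using ray_mem[OF S(2,3) z] that by simp
    have lin: "linear (frechet_derivative H (at x))" if "x \<in> S" for x
      using smooth_on_has_derivative[OF H that] has_derivative_linear by blast
    have w': "(w has_derivative (\<lambda>h. h *\<^sub>R (z - q))) (at t within {0..1})" for t
      unfolding w_def by (auto intro!: derivative_eq_intros)
    have "((\<lambda>t. H (w t)) has_vector_derivative frechet_derivative H (at (w t)) (z - q)) (at t within {0..1})"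
      if t: "t \<in> {0..1}" for t
      using has_derivative_compose[OF w' smooth_on_has_derivative[OF H wS[OF t]]] linear_scale[OF lin[OF wS[OF t]]]
      by (simp add: has_vector_derivative_def)
    then have "((\<lambda>t. frechet_derivative H (at (w t)) (z - q)) has_integral H (w 1) - H (w 0)) {0..1}"
      by (intro fundamental_theorem_of_calculus) auto
    then have "H z - H q = integral {0..1} (\<lambda>t. frechet_derivative H (at (w t)) (z - q))"
      by (simp add: w_def integral_unique)
    also have "\<dots> = integral {0..1} (\<lambda>t. \<Sum>b\<in>B. inner (z - q) b * (t ^ 0 * frechet_derivative H (at (w t)) b))"
    proof (rule integral_cong)
      fix t :: real assume "t \<in> {0..1}"
      then show "frechet_derivative H (at (w t)) (z - q)
          = (\<Sum>b\<in>B. inner (z - q) b * (t ^ 0 * frechet_derivative H (at (w t)) b))"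
        by (subst linear_expansion[OF lin[OF wS]]) simp_all
    qed
    also have "\<dots> = (\<Sum>b\<in>B. inner (z - q) b * G b z)"
      unfolding G_def ray_integral_def w_def
      by (subst integral_sum)
         (simp_all add: finite_basis integrable_continuous_interval[OF continuous_on_mult_left[OF
           continuous_on_ray[OF S(2,3) z smooth_on_imp_continuous_on[OF smooth_on_frechet_derivative[OF H]],
           where j = 0, simplified]]])
    finally show ?thesis by simp
  qed
  with that sm at_q show thesis by blast
qed

end

section \<open>Smooth functions, tangent vectors and local frames\<close>

locale smooth_manifold = orthonormal_basis B for B :: "'e::real_inner set" +
  fixes A :: "('a::t2_space, 'e) chart set"
  assumes atlas: "smooth_atlas A"
begin

section \<open>Charts\<close>

lemma chart:
  assumes "(U, \<phi>) \<in> A"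
  shows "open U" "open (\<phi> ` U)" "homeomorphism U (\<phi> ` U) \<phi> (inv_into U \<phi>)"
proof -
  have "\<forall>(U, \<phi>)\<in>A. open U \<and> open (\<phi> ` U) \<and> homeomorphism U (\<phi> ` U) \<phi> (inv_into U \<phi>)"
    using atlas by (simp add: smooth_atlas_def)
  from bspec[OF this assms] show "open U" "open (\<phi> ` U)" "homeomorphism U (\<phi> ` U) \<phi> (inv_into U \<phi>)"
    by simp_all
qed

lemma chart_around: obtains U \<phi> where "(U, \<phi>) \<in> A" "x \<in> U"
proof -
  have "x \<in> (\<Union>(U, \<phi>)\<in>A. U)" using atlas by (simp add: smooth_atlas_def)
  then show thesis using that by auto
qed

lemma chart_inv:
  assumes "(U, \<phi>) \<in> A"
  shows "x \<in> U \<Longrightarrow> inv_into U \<phi> (\<phi> x) = x"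
    and "z \<in> \<phi> ` U \<Longrightarrow> inv_into U \<phi> z \<in> U"
    and "z \<in> \<phi> ` U \<Longrightarrow> \<phi> (inv_into U \<phi> z) = z"
  using chart(3)[OF assms] by (auto simp: homeomorphism_def)

lemma transition_smooth:
  assumes "(U, \<phi>) \<in> A" "(V, \<psi>) \<in> A"
  shows "smooth_on (\<phi> ` (U \<inter> V)) (\<lambda>z. \<psi> (inv_into U \<phi> z))"
proof -
  have "\<forall>(U, \<phi>)\<in>A. \<forall>(V, \<psi>)\<in>A. smooth_on (\<phi> ` (U \<inter> V)) (\<psi> \<circ> inv_into U \<phi>)"
    using atlas by (simp add: smooth_atlas_def)
  from bspec[OF this assms(1)] assms(2) show ?thesis by (auto simp: o_def)
qed

lemma chart_image_open:
  assumes "(U, \<phi>) \<in> A" "open S"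
  shows "open (\<phi> ` (U \<inter> S))"
proof -
  have "open (inv_into U \<phi> -` S \<inter> \<phi> ` U)"
    using chart[OF assms(1)] assms(2) continuous_open_preimage[of "\<phi> ` U" "inv_into U \<phi>" S]
    by (simp add: homeomorphism_def Int_commute)
  moreover have "\<phi> ` (U \<inter> S) = inv_into U \<phi> -` S \<inter> \<phi> ` U"
    using chart_inv[OF assms(1)] by auto
  ultimately show ?thesis by simp
qed

lemma chart_preimage_open:
  assumes "(U, \<phi>) \<in> A" "open S"
  shows "open (U \<inter> \<phi> -` S)"
  using chart[OF assms(1)] assms(2) continuous_open_preimage[of U \<phi> S]
  by (auto simp: homeomorphism_def vimage_def Int_def conj_commute)

section \<open>The algebra of smooth functions\<close>

lemma smooth_functions_iff:
  "f \<in> smooth_functions A \<longleftrightarrow> (\<forall>(U, \<phi>)\<in>A. smooth_on (\<phi> ` U) (\<lambda>z. f (inv_into U \<phi> z)))"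
  by (simp add: smooth_functions_def o_def)

lemma smooth_functionsD:
  "f \<in> smooth_functions A \<Longrightarrow> (U, \<phi>) \<in> A \<Longrightarrow> smooth_on (\<phi> ` U) (\<lambda>z. f (inv_into U \<phi> z))"
  by (auto simp: smooth_functions_iff)

lemma smooth_functionsI:
  "(\<And>U \<phi>. (U, \<phi>) \<in> A \<Longrightarrow> smooth_on (\<phi> ` U) (\<lambda>z. f (inv_into U \<phi> z))) \<Longrightarrow> f \<in> smooth_functions A"
  by (auto simp: smooth_functions_iff)

lemma smooth_functions_const: "(\<lambda>x. c) \<in> smooth_functions A"
  by (rule smooth_functionsI) (intro smooth_on_const chart(2))

lemma smooth_functions_add:
  "f \<in> smooth_functions A \<Longrightarrow> h \<in> smooth_functions A \<Longrightarrow> (\<lambda>x. f x + h x) \<in> smooth_functions A"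
  by (rule smooth_functionsI) (auto intro: smooth_on_add chart(2) dest: smooth_functionsD)

lemma smooth_functions_mult:
  "f \<in> smooth_functions A \<Longrightarrow> h \<in> smooth_functions A \<Longrightarrow> (\<lambda>x. f x * h x) \<in> smooth_functions A"
  by (rule smooth_functionsI) (auto intro: smooth_on_mult chart(2) dest: smooth_functionsD)

lemma smooth_functions_inverse:
  "f \<in> smooth_functions A \<Longrightarrow> (\<And>x. f x \<noteq> 0) \<Longrightarrow> (\<lambda>x. inverse (f x)) \<in> smooth_functions A"
  by (rule smooth_functionsI) (auto intro: smooth_on_inverse chart(2) dest: smooth_functionsD)

lemma smooth_functions_minus:
  "f \<in> smooth_functions A \<Longrightarrow> (\<lambda>x. - f x) \<in> smooth_functions A"
  using smooth_functions_mult[OF smooth_functions_const[of "-1"]] by simp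

lemma smooth_functions_diff:
  "f \<in> smooth_functions A \<Longrightarrow> h \<in> smooth_functions A \<Longrightarrow> (\<lambda>x. f x - h x) \<in> smooth_functions A"
  using smooth_functions_add[OF _ smooth_functions_minus] by simp

lemma smooth_functions_sum:
  "(\<And>i. i \<in> I \<Longrightarrow> f i \<in> smooth_functions A) \<Longrightarrow> (\<lambda>x. \<Sum>i\<in>I. f i x) \<in> smooth_functions A"
  by (induction I rule: infinite_finite_induct)
     (auto intro: smooth_functions_add smooth_functions_const)

lemmas smooth_functions_intros =
  smooth_functions_const smooth_functions_add smooth_functions_mult smooth_functions_minus
  smooth_functions_diff smooth_functions_sum

text \<open>Smoothness is defined only for functions on the whole manifold, so the local witness is
  a global smooth function that agrees with \<open>f\<close> near \<open>x\<close>.\<close>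

lemma smooth_functions_local:
  assumes "\<And>x. \<exists>W f'. open W \<and> x \<in> W \<and> f' \<in> smooth_functions A \<and> (\<forall>y\<in>W. f y = f' y)"
  shows "f \<in> smooth_functions A"
  unfolding smooth_functions_iff
proof clarify
  fix U \<phi> assume c: "(U, \<phi>) \<in> A"
  show "smooth_on (\<phi> ` U) (\<lambda>z. f (inv_into U \<phi> z))"
  proof (rule smooth_on_local)
    fix z assume "z \<in> \<phi> ` U"
    then obtain x where x: "x \<in> U" "z = \<phi> x" by auto
    obtain W f' where W: "open W" "x \<in> W" "f' \<in> smooth_functions A" "\<forall>y\<in>W. f y = f' y"
      using assms[of x] by blast
    have "smooth_on (\<phi> ` (U \<inter> W)) (\<lambda>z. f (inv_into U \<phi> z))"
    proof (rule smooth_on_cong)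
      show "open (\<phi> ` (U \<inter> W))" by (rule chart_image_open[OF c W(1)])
      show "smooth_on (\<phi> ` (U \<inter> W)) (\<lambda>z. f' (inv_into U \<phi> z))"
        by (rule smooth_on_subset[OF smooth_functionsD[OF W(3) c]]) auto
    qed (use W(4) chart_inv(1)[OF c] in auto)
    then show "\<exists>N. open N \<and> z \<in> N \<and> smooth_on N (\<lambda>z. f (inv_into U \<phi> z))"
      using x W(2) chart_image_open[OF c W(1)] by blast
  qed
qed

lemma smooth_functions_continuous:
  assumes "f \<in> smooth_functions A"
  shows "continuous_on UNIV f"
proof (rule continuous_at_imp_continuous_on, rule ballI)
  fix x
  obtain U \<phi> where c: "(U, \<phi>) \<in> A" "x \<in> U" by (rule chart_around)
  have "continuous_on U (\<lambda>y. f (inv_into U \<phi> (\<phi> y)))"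
    using chart(3)[OF c(1)]
    by (intro continuous_on_compose2[OF smooth_on_imp_continuous_on[OF smooth_functionsD[OF assms c(1)]]])
       (auto simp: homeomorphism_def)
  then have "continuous_on U f"
    using chart_inv(1)[OF c(1)] by (simp cong: continuous_on_cong)
  then show "isCont f x" using chart(1)[OF c(1)] c(2) by (simp add: continuous_on_eq_continuous_at)
qed

definition chart_extend :: "'a set \<Rightarrow> ('a \<Rightarrow> 'e) \<Rightarrow> ('e \<Rightarrow> real) \<Rightarrow> 'a \<Rightarrow> real" where
  "chart_extend U \<phi> F x = (if x \<in> U then F (\<phi> x) else 0)"

text \<open>Here the Hausdorff property acts: the compact support, carried back to the manifold, is
  closed, so the extension is 0 near every point outside \<open>U\<close>. Inside \<open>U\<close> a
  change of charts suffices.\<close>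

lemma chart_extend_smooth:
  assumes c: "(U, \<phi>) \<in> A" and F: "smooth_on (\<phi> ` U) F"
    and K: "compact K" "K \<subseteq> \<phi> ` U" "\<And>z. z \<in> \<phi> ` U \<Longrightarrow> z \<notin> K \<Longrightarrow> F z = 0"
  shows "chart_extend U \<phi> F \<in> smooth_functions A"
  unfolding smooth_functions_iff
proof clarify
  fix V \<psi> assume d: "(V, \<psi>) \<in> A"
  define f where "f = chart_extend U \<phi> F"
  define K' where "K' = inv_into U \<phi> ` K"
  have "compact K'"
    unfolding K'_def using chart(3)[OF c] K
    by (intro compact_continuous_image) (auto simp: homeomorphism_def intro: continuous_on_subset)
  then have K': "open (- K')" by (simp add: compact_imp_closed open_Compl)
  show "smooth_on (\<psi> ` V) (\<lambda>z. chart_extend U \<phi> F (inv_into V \<psi> z))"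
  proof (rule smooth_on_local)
    fix z assume "z \<in> \<psi> ` V"
    then obtain y where y: "y \<in> V" "z = \<psi> y" by auto
    show "\<exists>N. open N \<and> z \<in> N \<and> smooth_on N (\<lambda>z. chart_extend U \<phi> F (inv_into V \<psi> z))"
    proof (cases "y \<in> U")
      case True
      have op: "open (\<psi> ` (V \<inter> U))" by (rule chart_image_open[OF d chart(1)[OF c]])
      have "smooth_on (\<psi> ` (V \<inter> U)) (\<lambda>z. F (\<phi> (inv_into V \<psi> z)))"
        by (rule smooth_on_compose[OF op chart(2)[OF c] _ F transition_smooth[OF d c]])
           (auto simp: chart_inv(1)[OF d])
      then have "smooth_on (\<psi> ` (V \<inter> U)) (\<lambda>z. chart_extend U \<phi> F (inv_into V \<psi> z))"
        by (rule smooth_on_cong[OF op, rotated]) (auto simp: chart_inv(1)[OF d] chart_extend_def)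
      then show ?thesis using op True y by blast
    next
      case False
      have "K' \<subseteq> U" using K(2) chart_inv(2)[OF c] by (auto simp: K'_def)
      have op: "open (\<psi> ` (V \<inter> - K'))" by (rule chart_image_open[OF d K'])
      have "chart_extend U \<phi> F x = 0" if "x \<notin> K'" for x
      proof (cases "x \<in> U")
        case True
        then have "\<phi> x \<notin> K" using that chart_inv(1)[OF c True] by (force simp: K'_def)
        then show ?thesis using K(3) True by (simp add: chart_extend_def)
      qed (simp add: chart_extend_def)
      then have "smooth_on (\<psi> ` (V \<inter> - K')) (\<lambda>z. chart_extend U \<phi> F (inv_into V \<psi> z))"
        by (intro smooth_on_cong[OF op _ smooth_on_const[OF op, of 0]]) (auto simp: chart_inv(1)[OF d])
      then show ?thesis using op False \<open>K' \<subseteq> U\<close> y by blast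
    qed
  qed
qed

section \<open>Tangent vectors as derivations\<close>

lemma tangent_linear:
  "v \<in> tangent_space A x \<Longrightarrow> f \<in> smooth_functions A \<Longrightarrow> h \<in> smooth_functions A \<Longrightarrow>
    v (\<lambda>y. a * f y + b * h y) = a * v f + b * v h"
  by (simp add: tangent_space_def)

lemma tangent_mult:
  "v \<in> tangent_space A x \<Longrightarrow> f \<in> smooth_functions A \<Longrightarrow> h \<in> smooth_functions A \<Longrightarrow>
    v (\<lambda>y. f y * h y) = f x * v h + h x * v f"
  by (simp add: tangent_space_def)

lemma tangent_non_smooth: "v \<in> tangent_space A x \<Longrightarrow> f \<notin> smooth_functions A \<Longrightarrow> v f = 0"
  by (simp add: tangent_space_def)

text \<open>The product rule for \<open>1 = 1 * 1\<close> reads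
  \<open>v 1 = 2 * v 1\<close>.\<close>

lemma tangent_const: "v \<in> tangent_space A x \<Longrightarrow> v (\<lambda>y. c) = 0"
  using tangent_mult[of v x "\<lambda>y. 1" "\<lambda>y. 1"] tangent_linear[of v x "\<lambda>y. 1" "\<lambda>y. 1" c 0]
  by (simp add: smooth_functions_const)

lemma tangent_add:
  "v \<in> tangent_space A x \<Longrightarrow> f \<in> smooth_functions A \<Longrightarrow> h \<in> smooth_functions A \<Longrightarrow>
    v (\<lambda>y. f y + h y) = v f + v h"
  using tangent_linear[of v x f h 1 1] by simp

lemma tangent_diff:
  "v \<in> tangent_space A x \<Longrightarrow> f \<in> smooth_functions A \<Longrightarrow> h \<in> smooth_functions A \<Longrightarrow>
    v (\<lambda>y. f y - h y) = v f - v h"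
  using tangent_linear[of v x f h 1 "-1"] by simp

lemma tangent_sum:
  assumes "v \<in> tangent_space A x" "\<And>i. i \<in> I \<Longrightarrow> f i \<in> smooth_functions A"
  shows "v (\<lambda>y. \<Sum>i\<in>I. f i y) = (\<Sum>i\<in>I. v (f i))"
  using assms(2)
  by (induction I rule: infinite_finite_induct)
     (simp_all add: tangent_const[OF assms(1)] tangent_add[OF assms(1)] smooth_functions_sum)

lemma tangent_space_zero: "(\<lambda>f. 0) \<in> tangent_space A x"
  by (simp add: tangent_space_def)

lemma tangent_space_combine:
  "u \<in> tangent_space A x \<Longrightarrow> v \<in> tangent_space A x \<Longrightarrow> (\<lambda>f. a * u f + b * v f) \<in> tangent_space A x"
  by (simp add: tangent_space_def algebra_simps)

lemma tangent_space_sum: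
  "(\<And>i. i \<in> I \<Longrightarrow> u i \<in> tangent_space A x) \<Longrightarrow> (\<lambda>f. \<Sum>i\<in>I. c i * u i f) \<in> tangent_space A x"
proof (induction I rule: infinite_finite_induct)
  case (insert i I)
  then show ?case using tangent_space_combine[of "u i" x "\<lambda>f. \<Sum>i\<in>I. c i * u i f" "c i" 1] by simp
qed (simp_all add: tangent_space_zero)

section \<open>Smooth vector fields and Lie brackets\<close>

lemma vector_field_tangent: "X \<in> smooth_vector_fields A \<Longrightarrow> X x \<in> tangent_space A x"
  by (simp add: smooth_vector_fields_def)

lemma vector_field_smooth:
  "X \<in> smooth_vector_fields A \<Longrightarrow> f \<in> smooth_functions A \<Longrightarrow> (\<lambda>x. X x f) \<in> smooth_functions A"
  by (simp add: smooth_vector_fields_def)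

lemma vector_field_non_smooth:
  "X \<in> smooth_vector_fields A \<Longrightarrow> f \<notin> smooth_functions A \<Longrightarrow> X x f = 0"
  using tangent_non_smooth vector_field_tangent by blast

lemma vector_field_combine:
  assumes "X \<in> smooth_vector_fields A" "Y \<in> smooth_vector_fields A"
    "a \<in> smooth_functions A" "b \<in> smooth_functions A"
  shows "(\<lambda>x f. a x * X x f + b x * Y x f) \<in> smooth_vector_fields A"
  using assms unfolding smooth_vector_fields_def
  by (auto intro!: tangent_space_combine smooth_functions_intros)

lemma vector_field_sum:
  assumes "\<And>i. i \<in> I \<Longrightarrow> X i \<in> smooth_vector_fields A" "\<And>i. i \<in> I \<Longrightarrow> a i \<in> smooth_functions A"
  shows "(\<lambda>x f. \<Sum>i\<in>I. a i x * X i x f) \<in> smooth_vector_fields A"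
  using assms unfolding smooth_vector_fields_def
  by (auto intro!: tangent_space_sum smooth_functions_intros)

lemma lie_bracket_vector_field:
  assumes X: "X \<in> smooth_vector_fields A" and Y: "Y \<in> smooth_vector_fields A"
  shows "lie_bracket X Y \<in> smooth_vector_fields A"
proof -
  note XY = vector_field_tangent[OF X] vector_field_tangent[OF Y]
  have "lie_bracket X Y x \<in> tangent_space A x" for x
    unfolding tangent_space_def lie_bracket_def
  proof (intro CollectI conjI ballI allI impI)
    fix f h a b assume f: "f \<in> smooth_functions A" and h: "h \<in> smooth_functions A"
    note sm = vector_field_smooth[OF X f] vector_field_smooth[OF Y f]
      vector_field_smooth[OF X h] vector_field_smooth[OF Y h]
    show "X x (\<lambda>y. Y y (\<lambda>y. a * f y + b * h y)) - Y x (\<lambda>y. X y (\<lambda>y. a * f y + b * h y)) =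
      a * (X x (\<lambda>y. Y y f) - Y x (\<lambda>y. X y f)) + b * (X x (\<lambda>y. Y y h) - Y x (\<lambda>y. X y h))"
      using f h sm by (simp add: tangent_linear[OF XY(1)] tangent_linear[OF XY(2)] algebra_simps)
    show "X x (\<lambda>y. Y y (\<lambda>y. f y * h y)) - Y x (\<lambda>y. X y (\<lambda>y. f y * h y)) =
      f x * (X x (\<lambda>y. Y y h) - Y x (\<lambda>y. X y h)) + h x * (X x (\<lambda>y. Y y f) - Y x (\<lambda>y. X y f))"
      using f h sm
      by (simp add: tangent_mult[OF XY(1)] tangent_mult[OF XY(2)] tangent_add[OF XY(1)]
          tangent_add[OF XY(2)] smooth_functions_intros algebra_simps)
  next
    \<comment> \<open>For such \<open>f\<close> both inner functions are constantly 0, and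
      derivations kill constants.\<close>
    fix f assume "f \<notin> smooth_functions A"
    then show "X x (\<lambda>y. Y y f) - Y x (\<lambda>y. X y f) = 0"
      using tangent_const[OF XY(1)] tangent_const[OF XY(2)]
        vector_field_non_smooth[OF X] vector_field_non_smooth[OF Y] by simp
  qed
  moreover have "(\<lambda>x. lie_bracket X Y x f) \<in> smooth_functions A" if f: "f \<in> smooth_functions A" for f
    unfolding lie_bracket_def
    by (rule smooth_functions_diff[OF vector_field_smooth[OF X vector_field_smooth[OF Y f]]
          vector_field_smooth[OF Y vector_field_smooth[OF X f]]])
  ultimately show ?thesis by (simp add: smooth_vector_fields_def)
qed

text \<open>\<open>F\<close> may be arbitrary off \<open>T\<close>: there the cut-off
  \<open>s\<close> vanishes on a whole neighbourhood, because its support lies in the closed set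
  \<open>K\<close> inside \<open>T\<close>.\<close>

lemma smooth_on_mult_bump:
  fixes s F :: "'e \<Rightarrow> real"
  assumes "smooth_on UNIV s" "\<And>z. z \<notin> K \<Longrightarrow> s z = 0" "closed K" "K \<subseteq> T" "open S" "open T" "smooth_on T F"
  shows "smooth_on S (\<lambda>z. s z * F z)"
proof (rule smooth_on_local)
  fix z assume "z \<in> S"
  show "\<exists>N. open N \<and> z \<in> N \<and> smooth_on N (\<lambda>z. s z * F z)"
  proof (cases "z \<in> T")
    case True
    have "smooth_on T (\<lambda>z. s z * F z)"
      using assms smooth_on_subset[OF assms(1)] by (intro smooth_on_mult) auto
    then show ?thesis using True assms by blast
  next
    case False
    have op: "open (- K)" using assms(3) by (simp add: open_Compl)
    have "smooth_on (- K) (\<lambda>z. s z * F z)"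
      by (rule smooth_on_cong[OF op _ smooth_on_const[OF op, of 0]]) (use assms(2) in auto)
    then show ?thesis using False assms(4) op by blast
  qed
qed

text \<open>Coordinate functions and coordinate vector fields, cut off so as to be globally defined: they
  are dual to each other on \<open>W\<close>.  The function \<open>\<sigma>\<close> is supported in \<open>W\<close> and equal to \<open>1\<close> on \<open>W'\<close>.\<close>

definition coordinate_frame ::
  "'a set \<Rightarrow> 'a set \<Rightarrow> ('a \<Rightarrow> real) \<Rightarrow> ('e \<Rightarrow> 'a \<Rightarrow> real) \<Rightarrow> ('e \<Rightarrow> 'a vector_field) \<Rightarrow> bool" where
  "coordinate_frame W W' \<sigma> y E \<longleftrightarrow> open W' \<and> W' \<subseteq> W \<and> \<sigma> \<in> smooth_functions A \<and>
    (\<forall>x\<in>W'. \<sigma> x = 1) \<and> (\<forall>x. x \<notin> W \<longrightarrow> \<sigma> x = 0) \<and> (\<forall>x. 0 \<le> \<sigma> x) \<and>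
    (\<forall>b. y b \<in> smooth_functions A) \<and> (\<forall>b. E b \<in> smooth_vector_fields A) \<and>
    (\<forall>x\<in>W. \<forall>b\<in>B. \<forall>c\<in>B. E c x (y b) = (if b = c then 1 else 0)) \<and>
    (\<forall>x\<in>W. \<forall>v\<in>tangent_space A x. \<forall>f. v f = (\<Sum>b\<in>B. v (y b) * E b x f))"

lemma coordinate_frameD:
  assumes "coordinate_frame W W' \<sigma> y E"
  shows "open W'" "W' \<subseteq> W" "\<sigma> \<in> smooth_functions A"
    "x \<in> W' \<Longrightarrow> \<sigma> x = 1" "x \<notin> W \<Longrightarrow> \<sigma> x = 0" "0 \<le> \<sigma> x"
    "y b \<in> smooth_functions A" "E b \<in> smooth_vector_fields A"
    "x \<in> W \<Longrightarrow> b \<in> B \<Longrightarrow> c \<in> B \<Longrightarrow> E c x (y b) = (if b = c then 1 else 0)"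
    "x \<in> W \<Longrightarrow> v \<in> tangent_space A x \<Longrightarrow> v f = (\<Sum>b\<in>B. v (y b) * E b x f)"
  using assms unfolding coordinate_frame_def by (elim conjE, simp)+

text \<open>Coordinates and partial derivatives of a chart are multiplied by a bump function that is
  1 over \<open>W\<close>, so over \<open>W\<close> they behave as if uncut. The expansion of
  \<open>v\<close> is the fact that partial derivatives span the derivations.\<close>

lemma coordinate_frame_exists:
  "\<exists>W W' \<sigma> y E. coordinate_frame W W' \<sigma> y E \<and> x0 \<in> W'"
proof -
  obtain U \<phi> where c: "(U, \<phi>) \<in> A" "x0 \<in> U" by (rule chart_around)
  define p where "p = \<phi> x0"
  define \<theta> where "\<theta> = inv_into U \<phi>"
  have \<theta>\<phi>: "\<theta> (\<phi> x) = x" if "x \<in> U" for x using chart_inv(1)[OF c(1) that] by (simp add: \<theta>_def)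
  have opU: "open (\<phi> ` U)" by (rule chart(2)[OF c(1)])
  obtain R where R: "R > 0" "cball p R \<subseteq> \<phi> ` U"
    using opU c(2) open_contains_cball[of "\<phi> ` U"] by (auto simp: p_def)
  note ext = chart_extend_smooth[OF c(1) _ compact_cball[of p R] R(2)]
  \<comment> \<open>The radii are nested: \<open>s2\<close> is 1 up to \<open>R/9\<close> (over
    \<open>W'\<close>) and vanishes from \<open>R/3\<close> on (off \<open>W\<close>), while
    \<open>s1\<close> is 1 up to \<open>R/3\<close> (over \<open>W\<close>) and vanishes from
    \<open>2*R/3\<close> on, inside the ball of radius \<open>R\<close> where the functions to be
    cut off are smooth.\<close>
  have R3: "0 < R/3" "R/3 < 2*R/3" "0 < R/9" "R/9 < R/3" using R(1) by auto
  obtain s1 :: "'e \<Rightarrow> real" where s1: "smooth_on UNIV s1" "\<And>x. 0 \<le> s1 x" "\<And>x. s1 x \<le> 1"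
    "\<And>z. z \<in> cball p (R/3) \<Longrightarrow> s1 z = 1" "\<And>z. z \<notin> ball p (2*R/3) \<Longrightarrow> s1 z = 0"
    using bump_function_exists[OF R3(1,2), of p] by blast
  obtain s2 :: "'e \<Rightarrow> real" where s2: "smooth_on UNIV s2" "\<And>x. 0 \<le> s2 x" "\<And>x. s2 x \<le> 1"
    "\<And>z. z \<in> cball p (R/9) \<Longrightarrow> s2 z = 1" "\<And>z. z \<notin> ball p (R/3) \<Longrightarrow> s2 z = 0"
    using bump_function_exists[OF R3(3,4), of p] by blast
  have sub: "ball p (R/3) \<subseteq> cball p R" "ball p (2*R/3) \<subseteq> cball p R" "cball p (2*R/3) \<subseteq> ball p R"
    using R(1) by auto
  have sub0: "z \<notin> ball p (2*R/3)" if "z \<notin> ball p R" for z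
    using that R(1) by simp
  have cut: "chart_extend U \<phi> (\<lambda>z. s1 z * F z) \<in> smooth_functions A" if "smooth_on (ball p R) F" for F
  proof (rule ext)
    show "smooth_on (\<phi> ` U) (\<lambda>z. s1 z * F z)"
    proof (rule smooth_on_mult_bump[OF s1(1) _ closed_cball sub(3) opU open_ball that])
      show "s1 z = 0" if "z \<notin> cball p (2*R/3)" for z
        using s1(5)[of z] that ball_subset_cball by blast
    qed
    show "s1 z * F z = 0" if "z \<notin> cball p R" for z using s1(5)[of z] subsetD[OF sub(2), of z] that by auto
  qed
  define W where "W = U \<inter> \<phi> -` ball p (R/3)"
  define W' where "W' = U \<inter> \<phi> -` ball p (R/9)"
  define \<sigma> where "\<sigma> = chart_extend U \<phi> s2"
  define s where "s = chart_extend U \<phi> s1"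
  define y where "y b = chart_extend U \<phi> (\<lambda>z. s1 z * inner z b)" for b
  \<comment> \<open>The value 0 on non-smooth \<open>f\<close> is the convention of
    \<open>tangent_space\<close>.\<close>
  define E :: "'e \<Rightarrow> 'a vector_field" where "E b x f = (if f \<in> smooth_functions A then
    chart_extend U \<phi> (\<lambda>z. s1 z * frechet_derivative (\<lambda>z. f (\<theta> z)) (at z) b) x else 0)" for b x f
  have W: "open W'" "x0 \<in> W'" "W' \<subseteq> W"
    using R(1) c(2) chart_preimage_open[OF c(1) open_ball] by (auto simp: W_def W'_def p_def)
  have \<sigma>: "\<sigma> \<in> smooth_functions A"
    unfolding \<sigma>_def
  proof (rule ext[OF smooth_on_subset[OF s2(1)]])
    show "s2 z = 0" if "z \<notin> cball p R" for z using s2(5)[of z] subsetD[OF sub(1), of z] that by blast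
  qed simp
  have \<sigma>01: "\<And>x. x \<in> W' \<Longrightarrow> \<sigma> x = 1" "\<And>x. x \<notin> W \<Longrightarrow> \<sigma> x = 0" "\<And>x. 0 \<le> \<sigma> x"
    using s2 by (auto simp: \<sigma>_def chart_extend_def W_def W'_def)
  have s: "s \<in> smooth_functions A"
    using cut[OF smooth_on_const[OF open_ball, of _ _ 1]] by (simp add: s_def)
  have y: "y b \<in> smooth_functions A" for b
    unfolding y_def by (intro cut smooth_on_bounded_linear open_ball bounded_linear_inner_left)
  have smF: "smooth_on (\<phi> ` U) (\<lambda>z. f (\<theta> z))" if "f \<in> smooth_functions A" for f
    using smooth_functionsD[OF that c(1)] by (simp add: \<theta>_def)
  have ballU: "ball p R \<subseteq> \<phi> ` U" using R(2) ball_subset_cball by blast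
  have E: "E b \<in> smooth_vector_fields A" for b
    unfolding smooth_vector_fields_def
  proof (intro CollectI conjI allI ballI)
    fix f assume f: "f \<in> smooth_functions A"
    have "smooth_on (ball p R) (\<lambda>z. frechet_derivative (\<lambda>z. f (\<theta> z)) (at z) b)"
      by (rule smooth_on_frechet_derivative[OF smooth_on_subset[OF smF[OF f] ballU]])
    from cut[OF this] show "(\<lambda>x. E b x f) \<in> smooth_functions A" using f by (simp add: E_def)
  next
    fix x show "E b x \<in> tangent_space A x"
      unfolding tangent_space_def
    proof (intro CollectI conjI allI ballI impI)
      fix f h a k assume f: "f \<in> smooth_functions A" and h: "h \<in> smooth_functions A"
      have d: "((\<lambda>z. f (\<theta> z)) has_derivative frechet_derivative (\<lambda>z. f (\<theta> z)) (at (\<phi> x))) (at (\<phi> x))"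
         "((\<lambda>z. h (\<theta> z)) has_derivative frechet_derivative (\<lambda>z. h (\<theta> z)) (at (\<phi> x))) (at (\<phi> x))"
        if "x \<in> U"
        using smooth_on_has_derivative[OF smF[OF f]] smooth_on_has_derivative[OF smF[OF h]] that by auto
      have "frechet_derivative (\<lambda>z. a * f (\<theta> z) + k * h (\<theta> z)) (at (\<phi> x)) b =
          a * frechet_derivative (\<lambda>z. f (\<theta> z)) (at (\<phi> x)) b + k * frechet_derivative (\<lambda>z. h (\<theta> z)) (at (\<phi> x)) b"
        if "x \<in> U"
        using frechet_derivative_at[OF has_derivative_add[OF has_derivative_mult_right[OF d(1)[OF that], of a]
              has_derivative_mult_right[OF d(2)[OF that], of k]]] by metis
      then show "E b x (\<lambda>y. a * f y + k * h y) = a * E b x f + k * E b x h"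
        using f h by (simp add: E_def chart_extend_def smooth_functions_intros algebra_simps)
      have "frechet_derivative (\<lambda>z. f (\<theta> z) * h (\<theta> z)) (at (\<phi> x)) b =
          f x * frechet_derivative (\<lambda>z. h (\<theta> z)) (at (\<phi> x)) b + frechet_derivative (\<lambda>z. f (\<theta> z)) (at (\<phi> x)) b * h x"
        if "x \<in> U"
        using frechet_derivative_at[OF has_derivative_mult[OF d[OF that]]] \<theta>\<phi>[OF that] by metis
      then show "E b x (\<lambda>y. f y * h y) = f x * E b x h + h x * E b x f"
        using f h by (simp add: E_def chart_extend_def smooth_functions_intros algebra_simps)
    next
      fix f assume "f \<notin> smooth_functions A"
      then show "E b x f = 0" by (simp add: E_def)
    qed
  qed
  have EW: "E b x f = frechet_derivative (\<lambda>z. f (\<theta> z)) (at (\<phi> x)) b"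
    if "x \<in> W" "f \<in> smooth_functions A" for b x f
    using that s1(4)[of "\<phi> x"] by (simp add: E_def chart_extend_def W_def)
  \<comment> \<open>Cutting off changes nothing near a point of \<open>W\<close>, so derivatives
    there can be computed from the uncut function \<open>H\<close>.\<close>
  have near: "frechet_derivative (\<lambda>z. chart_extend U \<phi> F (\<theta> z)) (at (\<phi> x)) = D"
    if x: "x \<in> W" and F: "\<And>z. z \<in> ball p (R/3) \<Longrightarrow> F z = H z" and H: "(H has_derivative D) (at (\<phi> x))"
    for x F H D
  proof -
    have "((\<lambda>z. chart_extend U \<phi> F (\<theta> z)) has_derivative D) (at (\<phi> x))"
    proof (rule has_derivative_transform_within_open[OF H open_ball])
      show "\<phi> x \<in> ball p (R/3)" using x by (simp add: W_def)
      fix z assume z: "z \<in> ball p (R/3)"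
      then have "z \<in> \<phi> ` U" using sub R(2) by blast
      then show "H z = chart_extend U \<phi> F (\<theta> z)"
        using chart_inv(2,3)[OF c(1)] F[OF z] by (simp add: chart_extend_def \<theta>_def)
    qed
    then show ?thesis using frechet_derivative_at by metis
  qed
  have dual: "E k x (y b) = (if b = k then 1 else 0)" if "x \<in> W" "b \<in> B" "k \<in> B" for x b k
  proof -
    have "frechet_derivative (\<lambda>z. y b (\<theta> z)) (at (\<phi> x)) = (\<lambda>v. inner v b)"
      unfolding y_def
      by (rule near[OF that(1), where H = "\<lambda>z. inner z b"])
         (use s1(4) in \<open>auto intro!: bounded_linear_imp_has_derivative bounded_linear_inner_left\<close>)
    then show ?thesis using EW[OF that(1) y] inner_basis[OF that(3,2)] by simp
  qed
  have expand: "v f = (\<Sum>b\<in>B. v (y b) * E b x f)"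
    if x: "x \<in> W" and v: "v \<in> tangent_space A x" and f: "f \<in> smooth_functions A" for x v f
  proof -
    define q where "q = \<phi> x"
    have xU: "x \<in> U" and q: "q \<in> ball p (R/3)" using x by (auto simp: W_def q_def)
    then have sx: "s x = 1" and yx: "y b x = inner q b" for b
      using s1(4)[of q] by (auto simp: s_def y_def chart_extend_def q_def)
    have qR: "q \<in> ball p R" using q R(1) by auto
    \<comment> \<open>Apply \<open>v\<close> to \<open>s\<^sup>2 h = h(x) s\<^sup>2 + \<Sum> (y\<^sub>b - q\<^sub>b s) g\<^sub>b\<close>, which is Hadamard's lemma cut off by \<open>s\<^sup>2\<close>.
      The case \<open>h = s\<close> then shows \<open>v s = 0\<close>.\<close>
    have key: "v h = (\<Sum>b\<in>B. E b x h * (v (y b) - inner q b * v s))" if h: "h \<in> smooth_functions A" for h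
    proof -
      obtain G where G: "\<And>b. smooth_on (ball p R) (G b)"
        "\<And>b. G b q = frechet_derivative (\<lambda>z. h (\<theta> z)) (at q) b"
        "\<And>z. z \<in> ball p R \<Longrightarrow> h (\<theta> z) = h (\<theta> q) + (\<Sum>b\<in>B. inner (z - q) b * G b z)"
        using hadamard[OF open_ball convex_ball qR smooth_on_subset[OF smF[OF h] ballU]] by blast
      define g where "g b = chart_extend U \<phi> (\<lambda>z. s1 z * G b z)" for b
      have g: "g b \<in> smooth_functions A" for b unfolding g_def by (intro cut G(1))
      have gx: "g b x = E b x h" for b
        using G(2)[of b] EW[OF x h] s1(4)[of q] q xU by (simp add: g_def chart_extend_def q_def)
      \<comment> \<open>Two factors \<open>s\<close> are needed: one cuts off the linear factor,
        giving \<open>y b - inner q b * s\<close>, the other cuts off \<open>G b\<close>, giving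
        \<open>g b\<close>. All functions in the identity are then globally smooth.\<close>
      have eq: "(s u * s u) * h u = h x * (s u * s u) + (\<Sum>b\<in>B. (y b u - inner q b * s u) * g b u)" for u
      proof (cases "u \<in> U \<and> \<phi> u \<in> ball p R")
        case True
        then have "h u = h x + (\<Sum>b\<in>B. inner (\<phi> u - q) b * G b (\<phi> u))"
          using G(3)[of "\<phi> u"] \<theta>\<phi> xU by (simp add: q_def)
        then have "(s u * s u) * h u = (s u * s u) * h x + (\<Sum>b\<in>B. (s u * s u) * (inner (\<phi> u - q) b * G b (\<phi> u)))"
          by (simp add: distrib_left sum_distrib_left)
        also have "(\<Sum>b\<in>B. (s u * s u) * (inner (\<phi> u - q) b * G b (\<phi> u)))
            = (\<Sum>b\<in>B. (y b u - inner q b * s u) * g b u)"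
          using True by (intro sum.cong) (auto simp: s_def y_def g_def chart_extend_def inner_diff_left algebra_simps)
        finally show ?thesis by (simp add: mult.commute)
      next
        case False
        then have "s u = 0" "y b u = 0" for b
          using s1(5)[of "\<phi> u"] sub0[of "\<phi> u"] by (auto simp: s_def y_def chart_extend_def)
        then show ?thesis by simp
      qed
      have "v (\<lambda>u. (s u * s u) * h u) = v (\<lambda>u. h x * (s u * s u) + (\<Sum>b\<in>B. (y b u - inner q b * s u) * g b u))"
        using eq by simp
      moreover have "v (\<lambda>u. (s u * s u) * h u) = v h + 2 * h x * v s"
        by (simp add: tangent_mult[OF v] smooth_functions_intros s h sx)
      moreover have "v (\<lambda>u. h x * (s u * s u) + (\<Sum>b\<in>B. (y b u - inner q b * s u) * g b u))
          = h x * (2 * v s) + (\<Sum>b\<in>B. g b x * (v (y b) - inner q b * v s))"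
        by (simp add: tangent_const[OF v] tangent_mult[OF v] tangent_add[OF v] tangent_diff[OF v]
            tangent_sum[OF v] smooth_functions_intros s g y sx yx)
      ultimately show ?thesis by (simp add: gx)
    qed
    have "frechet_derivative (\<lambda>z. s (\<theta> z)) (at (\<phi> x)) = (\<lambda>v. 0)"
      unfolding s_def by (rule near[OF x, where H = "\<lambda>z. 1"]) (use s1(4) in auto)
    then have "E b x s = 0" for b using EW[OF x s] by simp
    then have "v s = 0" using key[OF s] by simp
    then show ?thesis using key[OF f] by (simp add: mult.commute)
  qed
  have "v f = (\<Sum>b\<in>B. v (y b) * E b x f)" if "x \<in> W" "v \<in> tangent_space A x" for x v f
    using expand[OF that] tangent_non_smooth[OF that(2)] vector_field_non_smooth[OF E]
    by (cases "f \<in> smooth_functions A") auto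
  then have "coordinate_frame W W' \<sigma> y E"
    unfolding coordinate_frame_def using W \<sigma> \<sigma>01 y E dual by blast
  then show ?thesis using W(2) by blast
qed

end

section \<open>Inverting a matrix of functions\<close>

text \<open>Reciprocals are deliberately absent: the determinant of the matrix may vanish at some
  points, and the entries of the adjugate are polynomials in the entries.\<close>

locale function_algebra =
  fixes C :: "('a \<Rightarrow> 'b::field) set"
  assumes const: "(\<lambda>x. c) \<in> C"
    and add: "f \<in> C \<Longrightarrow> h \<in> C \<Longrightarrow> (\<lambda>x. f x + h x) \<in> C"
    and mult: "f \<in> C \<Longrightarrow> h \<in> C \<Longrightarrow> (\<lambda>x. f x * h x) \<in> C"
begin

lemma det_mem:
  assumes a: "\<And>i j. i < n \<Longrightarrow> j < n \<Longrightarrow> a i j \<in> C"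
  shows "(\<lambda>x. det (mat n n (\<lambda>(i, j). a i j x))) \<in> C"
proof -
  have sum: "(\<lambda>x. \<Sum>i\<in>I. f i x) \<in> C" if "\<And>i. i \<in> I \<Longrightarrow> f i \<in> C" for I :: "(nat \<Rightarrow> nat) set" and f
    using that by (induction I rule: infinite_finite_induct) (auto intro: const add)
  have prod: "(\<lambda>x. \<Prod>i\<in>I. f i x) \<in> C" if "\<And>i. i \<in> I \<Longrightarrow> f i \<in> C" for I :: "nat set" and f
    using that by (induction I rule: infinite_finite_induct) (auto intro: const mult)
  have "(\<lambda>x. \<Sum>p\<in>{p. p permutes {0..<n}}. signof p * (\<Prod>i = 0..<n. a i (p i) x)) \<in> C"
  proof (intro sum mult const prod)
    fix p i assume p: "p \<in> {p. p permutes {0..<n}}" and i: "i \<in> {0..<n}"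
    then have "p i < n" using permutes_in_image by fastforce
    then show "a i (p i) \<in> C" using a i by simp
  qed
  moreover have "det (mat n n (\<lambda>(i, j). a i j x)) =
      (\<Sum>p\<in>{p. p permutes {0..<n}}. signof p * (\<Prod>i = 0..<n. a i (p i) x))" for x
    by (subst det_def'[where n = n])
       (auto intro!: sum.cong prod.cong dest: permutes_in_image)
  ultimately show ?thesis by simp
qed

lemma adjugate_mem_nat:
  fixes n :: nat
  assumes a: "\<And>i j. i < n \<Longrightarrow> j < n \<Longrightarrow> a i j \<in> C"
  obtains d e where "d \<in> C" "\<And>i j. i < n \<Longrightarrow> j < n \<Longrightarrow> e i j \<in> C"
    "\<And>x i k. i < n \<Longrightarrow> k < n \<Longrightarrow> (\<Sum>j<n. a i j x * e j k x) = (if i = k then d x else 0)"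
    "\<And>x. d x = 0 \<Longrightarrow> \<exists>w. (\<exists>i<n. w i \<noteq> 0) \<and> (\<forall>i<n. (\<Sum>j<n. a i j x * w j) = 0)"
proof -
  define M where "M x = mat n n (\<lambda>(i, j). a i j x)" for x
  define e where "e i j x = adj_mat (M x) $$ (i, j)" for i j x
  have M: "M x \<in> carrier_mat n n" for x by (simp add: M_def)
  have e: "e i j \<in> C" if ij: "i < n" "j < n" for i j
  proof -
    \<comment> \<open>The adjugate is the transpose of the cofactor matrix, hence row
      \<open>j\<close> and column \<open>i\<close> are deleted; indices from the deleted one on
      shift by one.\<close>
    have del: "mat_delete (M x) j i = mat (n - 1) (n - 1)
        (\<lambda>(k, l). a (if k < j then k else Suc k) (if l < i then l else Suc l) x)" for x
      using ij by (intro eq_matI) (auto simp: mat_delete_def M_def)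
    have "(\<lambda>x. det (mat_delete (M x) j i)) \<in> C"
      unfolding del
      by (rule det_mem[where a = "\<lambda>k l. a (if k < j then k else Suc k) (if l < i then l else Suc l)"])
         (rule a, use ij in auto)
    then have "(\<lambda>x. (- 1) ^ (j + i) * det (mat_delete (M x) j i)) \<in> C"
      by (rule mult[OF const])
    moreover have "e i j x = (- 1) ^ (j + i) * det (mat_delete (M x) j i)" for x
      using ij M[of x] by (simp add: e_def adj_mat_def cofactor_def)
    then have "e i j = (\<lambda>x. (- 1) ^ (j + i) * det (mat_delete (M x) j i))" by (rule ext)
    ultimately show ?thesis by simp
  qed
  have d: "(\<lambda>x. det (M x)) \<in> C" unfolding M_def by (rule det_mem[OF a])
  have inv: "(\<Sum>j<n. a i j x * e j k x) = (if i = k then det (M x) else 0)"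
    if ik: "i < n" "k < n" for x i k
  proof -
    have "(M x * adj_mat (M x)) $$ (i, k) = (\<Sum>j<n. a i j x * e j k x)"
      using ik adj_mat(1)[OF M[of x]]
      by (simp add: scalar_prod_def M_def e_def atLeast0LessThan)
    then show ?thesis using adj_mat(2)[OF M[of x]] ik by (cases "i = k") auto
  qed
  have ker: "\<exists>w. (\<exists>i<n. w i \<noteq> 0) \<and> (\<forall>i<n. (\<Sum>j<n. a i j x * w j) = 0)" if d0: "det (M x) = 0" for x
  proof -
    obtain v where v: "v \<in> carrier_vec n" "v \<noteq> 0\<^sub>v n" "M x *\<^sub>v v = 0\<^sub>v n"
      using d0 unfolding det_0_iff_vec_prod_zero[OF M] by blast
    have "\<exists>i<n. vec_index v i \<noteq> 0"
    proof (rule ccontr)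
      assume "\<not> ?thesis"
      then have "v = 0\<^sub>v n" using v(1) by (intro eq_vecI) auto
      then show False using v(2) by simp
    qed
    moreover have "(\<Sum>j<n. a i j x * vec_index v j) = 0" if "i < n" for i
    proof -
      have "vec_index (M x *\<^sub>v v) i = (\<Sum>j<n. a i j x * vec_index v j)"
        using that v(1) by (simp add: scalar_prod_def M_def atLeast0LessThan)
      then show ?thesis using v(3) that by simp
    qed
    ultimately show ?thesis by blast
  qed
  show thesis
    by (rule that[of "\<lambda>x. det (M x)" e]) (fact d, fact e, fact inv, fact ker)
qed

text \<open>The identity "matrix times adjugate equals determinant" holds at singular points too.
  The kernel clause, with \<open>w\<close> depending on the point, is how non-degeneracy will later
  exclude \<open>d x = 0\<close>. A bijection with an initial segment of \<open>nat\<close>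
  transfers the matrix statement to any finite index set.\<close>

lemma adjugate_mem:
  fixes I :: "'i set"
  assumes I: "finite I" and a: "\<And>i j. i \<in> I \<Longrightarrow> j \<in> I \<Longrightarrow> a i j \<in> C"
  shows "\<exists>d e. d \<in> C \<and> (\<forall>i\<in>I. \<forall>j\<in>I. e i j \<in> C) \<and>
    (\<forall>x. \<forall>i\<in>I. \<forall>k\<in>I. (\<Sum>j\<in>I. a i j x * e j k x) = (if i = k then d x else 0)) \<and>
    (\<forall>x. d x = 0 \<longrightarrow> (\<exists>w. (\<exists>i\<in>I. w i \<noteq> 0) \<and> (\<forall>i\<in>I. (\<Sum>j\<in>I. a i j x * w j) = 0)))"
proof -
  obtain \<beta> where "bij_betw \<beta> {0..<card I} I" using ex_bij_betw_nat_finite[OF I] by blast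
  then have \<beta>: "bij_betw \<beta> {..<card I} I" by (simp add: atLeast0LessThan)
  define \<gamma> where "\<gamma> = inv_into {..<card I} \<beta>"
  have \<beta>I: "\<beta> k \<in> I" "\<gamma> (\<beta> k) = k" if "k < card I" for k
    using that \<beta> by (auto simp: bij_betw_def \<gamma>_def inj_on_def)
  have \<gamma>I: "\<gamma> i < card I" "\<beta> (\<gamma> i) = i" if "i \<in> I" for i
    using that \<beta> bij_betw_inv_into_right[OF \<beta>] bij_betwE[OF bij_betw_inv_into[OF \<beta>]]
    by (auto simp: \<gamma>_def)
  have sum: "(\<Sum>i\<in>I. f i) = (\<Sum>k<card I. f (\<beta> k))" for f :: "'i \<Rightarrow> 'b"
    by (rule sum.reindex_bij_betw[OF \<beta>, symmetric])
  have a': "a (\<beta> i) (\<beta> j) \<in> C" if "i < card I" "j < card I" for i j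
    using a \<beta>I(1) that by simp
  show ?thesis
  proof (rule adjugate_mem_nat[of "card I" "\<lambda>i j. a (\<beta> i) (\<beta> j)"], rule a', assumption+)
    fix d e assume de: "d \<in> C" "\<And>i j. i < card I \<Longrightarrow> j < card I \<Longrightarrow> e i j \<in> C"
      "\<And>x i k. i < card I \<Longrightarrow> k < card I \<Longrightarrow>
        (\<Sum>j<card I. a (\<beta> i) (\<beta> j) x * e j k x) = (if i = k then d x else 0)"
      "\<And>x. d x = 0 \<Longrightarrow> \<exists>w. (\<exists>i<card I. w i \<noteq> 0) \<and>
        (\<forall>i<card I. (\<Sum>j<card I. a (\<beta> i) (\<beta> j) x * w j) = 0)"
    show ?thesis
    proof (intro exI[of _ d] exI[of _ "\<lambda>i j. e (\<gamma> i) (\<gamma> j)"] conjI ballI allI impI)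
      show "d \<in> C" by fact
      show "e (\<gamma> i) (\<gamma> j) \<in> C" if "i \<in> I" "j \<in> I" for i j using de(2) \<gamma>I that by simp
      show "(\<Sum>j\<in>I. a i j x * e (\<gamma> j) (\<gamma> k) x) = (if i = k then d x else 0)" if "i \<in> I" "k \<in> I" for x i k
      proof -
        have "(\<Sum>j\<in>I. a i j x * e (\<gamma> j) (\<gamma> k) x) = (\<Sum>j<card I. a (\<beta> (\<gamma> i)) (\<beta> j) x * e j (\<gamma> k) x)"
          unfolding sum using \<beta>I \<gamma>I(2)[OF that(1)] by (intro sum.cong) auto
        also have "\<dots> = (if \<gamma> i = \<gamma> k then d x else 0)" using de(3) \<gamma>I(1) that by simp
        also have "\<gamma> i = \<gamma> k \<longleftrightarrow> i = k" using \<gamma>I(2) that by metis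
        finally show ?thesis .
      qed
      show "\<exists>w. (\<exists>i\<in>I. w i \<noteq> 0) \<and> (\<forall>i\<in>I. (\<Sum>j\<in>I. a i j x * w j) = 0)" if d0: "d x = 0" for x
      proof -
        obtain w i where w: "i < card I" "w i \<noteq> 0"
          "\<And>i. i < card I \<Longrightarrow> (\<Sum>j<card I. a (\<beta> i) (\<beta> j) x * w j) = 0"
          using de(4)[OF d0] by blast
        have "(\<Sum>j\<in>I. a k j x * w (\<gamma> j)) = 0" if "k \<in> I" for k
        proof -
          have "(\<Sum>j\<in>I. a k j x * w (\<gamma> j)) = (\<Sum>j<card I. a (\<beta> (\<gamma> k)) (\<beta> j) x * w j)"
            unfolding sum using \<beta>I \<gamma>I(2)[OF that] by (intro sum.cong) auto
          then show ?thesis using w(3)[OF \<gamma>I(1)[OF that]] by simp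
        qed
        moreover have "\<beta> i \<in> I" "w (\<gamma> (\<beta> i)) \<noteq> 0" using \<beta>I w by auto
        ultimately show ?thesis by (intro exI[of _ "\<lambda>j. w (\<gamma> j)"]) blast
      qed
    qed
  qed
qed

end

section \<open>Gradients\<close>

locale form_manifold = smooth_manifold B A for B :: "'e::real_inner set"
    and A :: "('a::t2_space, 'e) chart set" +
  fixes g :: "'a \<Rightarrow> 'a tangent_vector \<Rightarrow> 'a tangent_vector \<Rightarrow> real"
  assumes form: "smooth_nondegenerate_form A g"
begin

sublocale function_algebra "smooth_functions A"
  by standard (simp_all add: smooth_functions_intros)

lemma form_linear:
  assumes "u \<in> tangent_space A x" "v \<in> tangent_space A x" "w \<in> tangent_space A x"
  shows "g x (\<lambda>f. a * u f + b * v f) w = a * g x u w + b * g x v w"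
  using form assms unfolding smooth_nondegenerate_form_def by (elim conjE) simp

lemma form_sym:
  assumes "u \<in> tangent_space A x" "v \<in> tangent_space A x"
  shows "g x u v = g x v u"
  using form assms unfolding smooth_nondegenerate_form_def by (elim conjE) simp

lemma form_nondegenerate:
  assumes "u \<in> tangent_space A x" "\<And>v. v \<in> tangent_space A x \<Longrightarrow> g x u v = 0"
  shows "u = (\<lambda>f. 0)"
  using form assms unfolding smooth_nondegenerate_form_def by (elim conjE) simp

lemma form_smooth:
  assumes "X \<in> smooth_vector_fields A" "Y \<in> smooth_vector_fields A"
  shows "(\<lambda>x. g x (X x) (Y x)) \<in> smooth_functions A"
  using form assms unfolding smooth_nondegenerate_form_def by (elim conjE) simp

lemma form_zero: "v \<in> tangent_space A x \<Longrightarrow> g x (\<lambda>f. 0) v = 0"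
  using form_linear[of v x v v 0 0] by simp

lemma form_sum:
  assumes "\<And>i. i \<in> I \<Longrightarrow> u i \<in> tangent_space A x" "w \<in> tangent_space A x"
  shows "g x (\<lambda>f. \<Sum>i\<in>I. c i * u i f) w = (\<Sum>i\<in>I. c i * g x (u i) w)"
  using assms(1)
proof (induction I rule: infinite_finite_induct)
  case (insert i I)
  have "g x (\<lambda>f. c i * u i f + 1 * (\<Sum>i\<in>I. c i * u i f)) w
      = c i * g x (u i) w + 1 * g x (\<lambda>f. \<Sum>i\<in>I. c i * u i f) w"
    using insert.prems by (intro form_linear assms(2) tangent_space_sum) auto
  then show ?case using insert by simp
qed (simp_all add: form_zero[OF assms(2)])

lemma form_eqI:
  assumes "u \<in> tangent_space A x" "w \<in> tangent_space A x"
    "\<And>v. v \<in> tangent_space A x \<Longrightarrow> g x u v = g x w v"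
  shows "u = w"
proof -
  have "(\<lambda>f. 1 * u f + (- 1) * w f) = (\<lambda>f. 0)"
  proof (rule form_nondegenerate)
    show "(\<lambda>f. 1 * u f + (- 1) * w f) \<in> tangent_space A x"
      using assms(1,2) by (rule tangent_space_combine)
    show "g x (\<lambda>f. 1 * u f + (- 1) * w f) v = 0" if "v \<in> tangent_space A x" for v
      using form_linear[OF assms(1,2) that, of 1 "-1"] assms(3)[OF that] by simp
  qed
  then show ?thesis by (simp add: fun_eq_iff)
qed

lemma form_frame_expansion:
  assumes "coordinate_frame W W' \<sigma> y E"
    and x: "x \<in> W" and u: "u \<in> tangent_space A x" and v: "v \<in> tangent_space A x"
  shows "g x u v = (\<Sum>b\<in>B. v (y b) * g x u (E b x))"
proof -
  note F = coordinate_frameD[OF assms(1)]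
  note E = vector_field_tangent[OF F(8)]
  have "v = (\<lambda>f. \<Sum>b\<in>B. v (y b) * E b x f)" using F(10)[OF x v] by (rule ext)
  then have "g x v u = g x (\<lambda>f. \<Sum>b\<in>B. v (y b) * E b x f) u" by simp
  also have "\<dots> = (\<Sum>b\<in>B. v (y b) * g x (E b x) u)" by (rule form_sum[OF E u])
  finally show ?thesis using form_sym[OF u v] form_sym[OF u E] by simp
qed

section \<open>Existence, smoothness and Leibniz rule of gradients\<close>

lemma gradient_eqI:
  assumes "w \<in> tangent_space A x" "\<And>v. v \<in> tangent_space A x \<Longrightarrow> v f = g x w v"
  shows "gradient A g f x = w"
  unfolding gradient_def
proof (rule the_equality)
  show "w \<in> tangent_space A x \<and> (\<forall>v\<in>tangent_space A x. v f = g x w v)" using assms by blast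
  show "w' = w" if "w' \<in> tangent_space A x \<and> (\<forall>v\<in>tangent_space A x. v f = g x w' v)" for w'
    using that assms by (intro form_eqI[of w' x w]) auto
qed

text \<open>Cramer's rule for the Gram matrix of the frame yields a vector that represents
  \<open>df\<close>, with coefficients depending smoothly on the point. Existence and local
  smoothness come from the same formula and are therefore proved together.\<close>

lemma gradient_local:
  assumes f: "f \<in> smooth_functions A"
  shows "gradient A g f x0 \<in> tangent_space A x0 \<and> (\<forall>v\<in>tangent_space A x0. v f = g x0 (gradient A g f x0) v)
    \<and> (\<exists>U. open U \<and> x0 \<in> U \<and> (\<forall>h\<in>smooth_functions A. \<exists>k\<in>smooth_functions A. \<forall>x\<in>U. gradient A g f x h = k x))"
proof -
  obtain W W' \<sigma> y E where fr: "coordinate_frame W W' \<sigma> y E" and x0': "x0 \<in> W'"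
    using coordinate_frame_exists by blast
  note F = coordinate_frameD[OF fr]
  note E = vector_field_tangent[OF F(8)]
  define G where "G i j x = g x (E i x) (E j x)" for i j x
  have G: "G i j \<in> smooth_functions A" for i j unfolding G_def by (rule form_smooth[OF F(8) F(8)])
  obtain d e where "d \<in> smooth_functions A" "\<forall>i\<in>B. \<forall>j\<in>B. e i j \<in> smooth_functions A"
    "\<forall>x. \<forall>i\<in>B. \<forall>k\<in>B. (\<Sum>j\<in>B. G i j x * e j k x) = (if i = k then d x else 0)"
    "\<forall>x. d x = 0 \<longrightarrow> (\<exists>w. (\<exists>i\<in>B. w i \<noteq> 0) \<and> (\<forall>i\<in>B. (\<Sum>j\<in>B. G i j x * w j) = 0))"
    using adjugate_mem[of B G, OF finite_basis G] by (elim exE conjE)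
  note de = this[rule_format]
  have G_sym: "G i j x = G j i x" for i j x unfolding G_def by (rule form_sym[OF E E])
  \<comment> \<open>A kernel vector \<open>w\<close> of the Gram matrix would make \<open>u\<close>,
    the sum of the \<open>w j * E j\<close>, orthogonal to every tangent vector, hence 0; but
    applying \<open>u\<close> to the dual coordinate \<open>y i\<close> returns
    \<open>w i\<close>.\<close>
  have d_nz: "d x \<noteq> 0" if x: "x \<in> W" for x
  proof
    assume "d x = 0"
    then obtain w i where w: "i \<in> B" "w i \<noteq> 0" "\<And>i. i \<in> B \<Longrightarrow> (\<Sum>j\<in>B. G i j x * w j) = 0"
      using de(4) by blast
    define u where "u = (\<lambda>f. \<Sum>j\<in>B. w j * E j x f)"
    have u: "u \<in> tangent_space A x" unfolding u_def by (rule tangent_space_sum[OF E])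
    have uE: "g x u (E k x) = 0" if "k \<in> B" for k
    proof -
      have "g x u (E k x) = (\<Sum>j\<in>B. w j * G j k x)"
        unfolding u_def G_def by (rule form_sum[OF E E])
      also have "\<dots> = (\<Sum>j\<in>B. G k j x * w j)" by (simp add: G_sym[of k] mult.commute)
      finally show ?thesis using w(3)[OF that] by simp
    qed
    have "u = (\<lambda>f. 0)" by (rule form_nondegenerate[OF u]) (simp add: form_frame_expansion[OF fr x u] uE)
    moreover have "u (y i) = w i"
    proof -
      have "u (y i) = (\<Sum>j\<in>B. if i = j then w j else 0)"
        unfolding u_def using F(9)[OF x w(1)] by (intro sum.cong) auto
      then show ?thesis using finite_basis w(1) by simp
    qed
    ultimately show False using w(2) by simp
  qed
  \<comment> \<open>Over \<open>W\<close> the matrix \<open>e / d\<close> is the inverse of the Gram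
    matrix; it is applied to the components \<open>E i x f\<close> of the differential.\<close>
  define c where "c k x = (\<Sum>i\<in>B. e k i x * inverse (d x) * E i x f)" for k x
  define r where "r x = (\<lambda>h. \<Sum>k\<in>B. c k x * E k x h)" for x
  have r: "r x \<in> tangent_space A x" for x unfolding r_def by (rule tangent_space_sum[OF E])
  have rE: "g x (r x) (E j x) = E j x f" if x: "x \<in> W" and j: "j \<in> B" for x j
  proof -
    have "g x (r x) (E j x) = (\<Sum>k\<in>B. c k x * G k j x)"
      unfolding r_def G_def by (rule form_sum[OF E E])
    also have "\<dots> = (\<Sum>k\<in>B. \<Sum>i\<in>B. G j k x * e k i x * (inverse (d x) * E i x f))"
      unfolding c_def G_sym[of _ j] by (simp add: sum_distrib_left sum_distrib_right mult_ac)
    also have "\<dots> = (\<Sum>i\<in>B. (\<Sum>k\<in>B. G j k x * e k i x) * (inverse (d x) * E i x f))"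
      by (subst sum.swap) (simp add: sum_distrib_right)
    also have "\<dots> = (\<Sum>i\<in>B. if j = i then E i x f else 0)"
      using de(3)[OF j] d_nz[OF x] by (intro sum.cong) auto
    finally show ?thesis using finite_basis j by simp
  qed
  have r_eq: "v f = g x (r x) v" if x: "x \<in> W" and v: "v \<in> tangent_space A x" for x v
    using F(10)[OF x v, of f] form_frame_expansion[OF fr x r v] rE[OF x] by simp
  have grad: "gradient A g f x = r x" if "x \<in> W" for x by (rule gradient_eqI[OF r r_eq[OF that]])
  have x0: "x0 \<in> W" using F(2) x0' by blast
  \<comment> \<open>a globally smooth function that agrees with \<open>1/d\<close> on \<open>W'\<close>: off \<open>W\<close>, where \<open>d\<close> may vanish,
    the denominator is at least \<open>1\<close>\<close>
  define d' where "d' x = d x * inverse (d x * d x + (1 - \<sigma> x) * (1 - \<sigma> x))" for x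
  have "d x * d x + (1 - \<sigma> x) * (1 - \<sigma> x) \<noteq> 0" for x
  proof (cases "x \<in> W")
    case True
    then have "d x * d x > 0" using d_nz[of x] by (auto simp: zero_less_mult_iff)
    moreover have "(1 - \<sigma> x) * (1 - \<sigma> x) \<ge> 0" by simp
    ultimately show ?thesis by linarith
  next
    case False
    then have "(1 - \<sigma> x) * (1 - \<sigma> x) = 1" using F(5) by simp
    moreover have "d x * d x \<ge> 0" by simp
    ultimately show ?thesis by linarith
  qed
  then have d': "d' \<in> smooth_functions A"
    unfolding d'_def by (intro smooth_functions_mult smooth_functions_inverse smooth_functions_add
        smooth_functions_diff smooth_functions_const de(1) F(3)) auto
  have dd: "d' x = inverse (d x)" if "x \<in> W'" for x
    using that subsetD[OF F(2) that] F(4)[OF that] d_nz[of x] by (auto simp: d'_def field_simps)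
  have "\<exists>k\<in>smooth_functions A. \<forall>x\<in>W'. gradient A g f x h = k x" if h: "h \<in> smooth_functions A" for h
  proof
    show "(\<lambda>x. \<Sum>k\<in>B. (\<Sum>i\<in>B. e k i x * d' x * E i x f) * E k x h) \<in> smooth_functions A"
      by (intro smooth_functions_sum smooth_functions_mult de(2) d' vector_field_smooth[OF F(8)] f h)
    show "\<forall>x\<in>W'. gradient A g f x h = (\<Sum>k\<in>B. (\<Sum>i\<in>B. e k i x * d' x * E i x f) * E k x h)"
      using grad F(2) dd by (auto simp: r_def c_def)
  qed
  then show ?thesis using grad[OF x0] r r_eq[OF x0] F(1) x0' by auto
qed

lemma gradient_vector_field:
  assumes f: "f \<in> smooth_functions A"
  shows "gradient A g f \<in> smooth_vector_fields A"
  unfolding smooth_vector_fields_def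
proof (intro CollectI conjI allI ballI)
  fix x show "gradient A g f x \<in> tangent_space A x" using gradient_local[OF f] by blast
next
  fix h assume h: "h \<in> smooth_functions A"
  show "(\<lambda>x. gradient A g f x h) \<in> smooth_functions A"
  proof (rule smooth_functions_local)
    fix x
    obtain U where "open U" "x \<in> U"
      "\<forall>h\<in>smooth_functions A. \<exists>k\<in>smooth_functions A. \<forall>x\<in>U. gradient A g f x h = k x"
      using gradient_local[OF f, of x] by blast
    then show "\<exists>W f'. open W \<and> x \<in> W \<and> f' \<in> smooth_functions A \<and> (\<forall>y\<in>W. gradient A g f y h = f' y)"
      using h by blast
  qed
qed

lemma form_gradient:
  "f \<in> smooth_functions A \<Longrightarrow> v \<in> tangent_space A x \<Longrightarrow> g x (gradient A g f x) v = v f"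
  using gradient_local[of f x] by auto

text \<open>Both sides are \<open>g(F, H)\<close> for the gradients \<open>F\<close> of
  \<open>f\<close> and \<open>H\<close> of \<open>h\<close>.\<close>

lemma gradient_apply_sym:
  assumes "f \<in> smooth_functions A" "h \<in> smooth_functions A"
  shows "gradient A g f x h = gradient A g h x f"
  using form_gradient[OF assms(1) vector_field_tangent[OF gradient_vector_field[OF assms(2)]], of x]
    form_gradient[OF assms(2) vector_field_tangent[OF gradient_vector_field[OF assms(1)]], of x]
    form_sym[OF vector_field_tangent[OF gradient_vector_field[OF assms(1)]]
      vector_field_tangent[OF gradient_vector_field[OF assms(2)]], of x]
  by simp

lemma gradient_linear:
  assumes f: "f \<in> smooth_functions A" and h: "h \<in> smooth_functions A"
  shows "gradient A g (\<lambda>x. a * f x + b * h x) = (\<lambda>x k. a * gradient A g f x k + b * gradient A g h x k)"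
proof
  fix x
  note T = vector_field_tangent[OF gradient_vector_field[OF f]] vector_field_tangent[OF gradient_vector_field[OF h]]
  show "gradient A g (\<lambda>x. a * f x + b * h x) x = (\<lambda>k. a * gradient A g f x k + b * gradient A g h x k)"
    by (rule gradient_eqI[OF tangent_space_combine[OF T]])
       (simp add: form_linear[OF T] form_gradient f h tangent_linear)
qed

lemma gradient_mult:
  assumes f: "f \<in> smooth_functions A" and h: "h \<in> smooth_functions A"
  shows "gradient A g (\<lambda>x. f x * h x) = (\<lambda>x k. f x * gradient A g h x k + h x * gradient A g f x k)"
proof
  fix x
  note T = vector_field_tangent[OF gradient_vector_field[OF h]] vector_field_tangent[OF gradient_vector_field[OF f]]
  show "gradient A g (\<lambda>x. f x * h x) x = (\<lambda>k. f x * gradient A g h x k + h x * gradient A g f x k)"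
    by (rule gradient_eqI[OF tangent_space_combine[OF T]])
       (simp add: form_linear[OF T] form_gradient f h tangent_mult)
qed

end

section \<open>Brackets of gradients\<close>

lemma real_span_base: "Z \<in> S \<Longrightarrow> Z \<in> real_span S"
  unfolding real_span_def by (intro CollectI exI[of _ "{Z}"] exI[of _ "\<lambda>_. 1"]) auto

lemma real_span_combine:
  assumes "Y \<in> real_span S" "Z \<in> real_span S"
  shows "(\<lambda>x f. a * Y x f + b * Z x f) \<in> real_span S"
proof -
  obtain T c where T: "finite T" "T \<subseteq> S" "Y = (\<lambda>x f. \<Sum>V\<in>T. c V * V x f)"
    using assms(1) by (auto simp: real_span_def)
  obtain U d where U: "finite U" "U \<subseteq> S" "Z = (\<lambda>x f. \<Sum>V\<in>U. d V * V x f)"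
    using assms(2) by (auto simp: real_span_def)
  define e where "e V = a * (if V \<in> T then c V else 0) + b * (if V \<in> U then d V else 0)" for V
  have "(\<Sum>V\<in>T \<union> U. e V * V x f) = a * Y x f + b * Z x f" for x f
  proof -
    have "(\<Sum>V\<in>T \<union> U. (if V \<in> T then c V else 0) * V x f) = Y x f"
      unfolding T(3) using T(1) U(1) by (intro sum.mono_neutral_cong_right) auto
    moreover have "(\<Sum>V\<in>T \<union> U. (if V \<in> U then d V else 0) * V x f) = Z x f"
      unfolding U(3) using T(1) U(1) by (intro sum.mono_neutral_cong_right) auto
    ultimately show ?thesis
      by (simp only: e_def distrib_right sum.distrib mult.assoc sum_distrib_left[symmetric])
  qed
  then show ?thesis
    unfolding real_span_def using T U by (intro CollectI exI[of _ "T \<union> U"] exI[of _ e]) auto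
qed

context form_manifold
begin

abbreviation L1 where "L1 \<equiv> gradient_brackets A g (Suc 0)"

lemma L1_combine: "Y \<in> L1 \<Longrightarrow> Z \<in> L1 \<Longrightarrow> (\<lambda>x f. a * Y x f + b * Z x f) \<in> L1"
  by (simp add: real_span_combine)

lemma L1_zero: "(\<lambda>x f. 0) \<in> L1"
  unfolding gradient_brackets.simps real_span_def by (intro CollectI exI[of _ "{}"]) simp

lemma L1_subset: "L1 \<subseteq> smooth_vector_fields A"
proof
  fix Z assume "Z \<in> L1"
  then obtain T c where T: "Z = (\<lambda>x f. \<Sum>V\<in>T. c V * V x f)" "T \<subseteq>
      {(\<lambda>x h. X x h + lie_bracket (gradient A g f) Y x h) | f X Y.
        f \<in> smooth_functions A \<and> X \<in> gradient_brackets A g 0 \<and> Y \<in> gradient_brackets A g 0}"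
    unfolding gradient_brackets.simps(2) real_span_def by blast
  have "V \<in> smooth_vector_fields A" if V: "V \<in> T" for V
  proof -
    obtain f h k where "f \<in> smooth_functions A" "h \<in> smooth_functions A" "k \<in> smooth_functions A"
      "V = (\<lambda>x l. gradient A g h x l + lie_bracket (gradient A g f) (gradient A g k) x l)"
      using subsetD[OF T(2) V] by auto
    then show ?thesis
      using vector_field_combine[OF gradient_vector_field[of h] lie_bracket_vector_field[OF
            gradient_vector_field[of f] gradient_vector_field[of k]] smooth_functions_const[of 1]
            smooth_functions_const[of 1]]
      by simp
  qed
  then have "(\<lambda>x f. \<Sum>V\<in>T. c V * V x f) \<in> smooth_vector_fields A"
    by (intro vector_field_sum smooth_functions_const)
  then show "Z \<in> smooth_vector_fields A" by (simp add: T(1))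
qed

text \<open>A generator has the form \<open>X + [grad f, Y]\<close>; the summand \<open>X\<close> is
  made to vanish as the gradient of 0.\<close>

lemma lie_bracket_gradients_L1:
  assumes "f \<in> smooth_functions A" "h \<in> smooth_functions A"
  shows "lie_bracket (gradient A g f) (gradient A g h) \<in> L1"
proof -
  have "gradient A g (\<lambda>x. 0) = (\<lambda>x l. 0)"
    using gradient_linear[OF assms, of 0 0] by simp
  then have "lie_bracket (gradient A g f) (gradient A g h)
      = (\<lambda>x l. gradient A g (\<lambda>x. 0) x l + lie_bracket (gradient A g f) (gradient A g h) x l)"
    by simp
  then show ?thesis
    unfolding gradient_brackets.simps
    by (intro real_span_base) (use assms smooth_functions_const[of 0] in blast)
qed

text \<open>The tensor \<open>T\<close> of the overview, defined for arbitrary fields so that its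
  slots can be expanded with smooth coefficients.\<close>

definition symmetric_product ::
  "'a vector_field \<Rightarrow> 'a vector_field \<Rightarrow> 'a vector_field \<Rightarrow> 'a vector_field" where
  "symmetric_product X Y Z = (\<lambda>x l.
    g x (X x) (Y x) * Z x l + g x (X x) (Z x) * Y x l + g x (Y x) (Z x) * X x l)"

definition gradient_product :: "('a \<Rightarrow> real) \<Rightarrow> ('a \<Rightarrow> real) \<Rightarrow> ('a \<Rightarrow> real) \<Rightarrow> 'a vector_field" where
  "gradient_product f h k = symmetric_product (gradient A g f) (gradient A g h) (gradient A g k)"

lemma gradient_product_eq:
  assumes "f \<in> smooth_functions A" "h \<in> smooth_functions A" "k \<in> smooth_functions A"
  shows "gradient_product f h k x l = gradient A g f x h * gradient A g k x l
    + gradient A g f x k * gradient A g h x l + gradient A g h x k * gradient A g f x l"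
  unfolding gradient_product_def symmetric_product_def
  using assms by (simp add: form_gradient vector_field_tangent gradient_vector_field gradient_apply_sym)

lemma symmetric_product_vector_field:
  assumes "X \<in> smooth_vector_fields A" "Y \<in> smooth_vector_fields A" "Z \<in> smooth_vector_fields A"
  shows "symmetric_product X Y Z \<in> smooth_vector_fields A"
proof -
  have "(\<lambda>x l. 1 * (g x (X x) (Y x) * Z x l + g x (X x) (Z x) * Y x l) + g x (Y x) (Z x) * X x l)
      \<in> smooth_vector_fields A"
    by (rule vector_field_combine[OF vector_field_combine[OF assms(3,2) form_smooth[OF assms(1,2)]
          form_smooth[OF assms(1,3)]] assms(1) smooth_functions_const form_smooth[OF assms(2,3)]])
  then show ?thesis by (simp add: symmetric_product_def)
qed

lemma gradient_product_vector_field: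
  "f \<in> smooth_functions A \<Longrightarrow> h \<in> smooth_functions A \<Longrightarrow> k \<in> smooth_functions A \<Longrightarrow>
    gradient_product f h k \<in> smooth_vector_fields A"
  unfolding gradient_product_def by (intro symmetric_product_vector_field gradient_vector_field)

text \<open>By the Leibniz rule \<open>[F, f H + h F] = F(f) H + f [F, H] + F(h) F\<close>, since
  \<open>[F, F] = 0\<close>, and \<open>[f F, H] = f [F, H] - H(f) F\<close>. In the difference
  \<open>f [F, H]\<close> drops out, and \<open>F(h) = H(f) = g(F, H)\<close>.\<close>

lemma gradient_product_diagonal_L1:
  assumes f: "f \<in> smooth_functions A" and h: "h \<in> smooth_functions A"
  shows "gradient_product f f h \<in> L1"
proof -
  let ?F = "gradient A g f" and ?H = "gradient A g h"
  have F: "?F \<in> smooth_vector_fields A" and H: "?H \<in> smooth_vector_fields A"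
    using f h by (auto intro: gradient_vector_field)
  have fh: "(\<lambda>x. f x * h x) \<in> smooth_functions A" "(\<lambda>x. f x * f x) \<in> smooth_functions A"
    "(\<lambda>x. 1/2 * (f x * f x)) \<in> smooth_functions A"
    by (intro smooth_functions_mult smooth_functions_const f h)+
  define Z where "Z = (\<lambda>x l. 1 * lie_bracket ?F (gradient A g (\<lambda>x. f x * h x)) x l
    + (- 1) * lie_bracket (gradient A g (\<lambda>x. 1/2 * (f x * f x))) ?H x l)"
  have Z: "Z \<in> L1"
    unfolding Z_def by (intro L1_combine lie_bracket_gradients_L1 f h fh)
  have sq: "gradient A g (\<lambda>x. 1/2 * (f x * f x)) = (\<lambda>x l. f x * ?F x l)"
    using gradient_linear[OF fh(2) fh(2), of "1/2" 0] gradient_mult[OF f f] by simp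
  have "gradient_product f f h x l = Z x l" for x l
  \<comment> \<open>The derivation rules hold for smooth \<open>l\<close> only; on other
    \<open>l\<close> both fields are 0 by convention.\<close>
  proof (cases "l \<in> smooth_functions A")
    case True
    note Fl = vector_field_smooth[OF F True] and Hl = vector_field_smooth[OF H True]
    note T = vector_field_tangent[OF F, of x] vector_field_tangent[OF H, of x]
    have 1: "?F x (\<lambda>y. f y * ?H y l + h y * ?F y l) =
        f x * ?F x (\<lambda>y. ?H y l) + ?H x l * ?F x f + h x * ?F x (\<lambda>y. ?F y l) + ?F x l * ?F x h"
      using f h Fl Hl by (simp add: tangent_add[OF T(1)] tangent_mult[OF T(1)] smooth_functions_mult)
    have 2: "?H x (\<lambda>y. f y * ?F y l) = f x * ?H x (\<lambda>y. ?F y l) + ?F x l * ?H x f"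
      using f Fl by (simp add: tangent_mult[OF T(2)])
    show ?thesis
      unfolding Z_def lie_bracket_def sq gradient_mult[OF f h] 1 2 gradient_product_eq[OF f f h]
      using gradient_apply_sym[OF f h, of x] by (simp add: algebra_simps)
  next
    case False
    then show ?thesis
      using vector_field_non_smooth[OF gradient_product_vector_field[OF f f h]]
        vector_field_non_smooth[OF subsetD[OF L1_subset Z]] by simp
  qed
  then have "gradient_product f f h = Z" by (intro ext)
  then show ?thesis using Z by simp
qed

text \<open>Polarisation:
  \<open>T(F + H, F + H, K) = T(F, F, K) + 2 T(F, H, K) + T(H, H, K)\<close>.\<close>

lemma gradient_product_L1:
  assumes f: "f \<in> smooth_functions A" and h: "h \<in> smooth_functions A" and k: "k \<in> smooth_functions A"
  shows "gradient_product f h k \<in> L1"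
proof -
  define s where "s x = 1 * f x + 1 * h x" for x
  have s: "s \<in> smooth_functions A" unfolding s_def using f h by (intro smooth_functions_intros)
  have gs: "gradient A g s = (\<lambda>x l. 1 * gradient A g f x l + 1 * gradient A g h x l)"
    unfolding s_def[abs_def] by (rule gradient_linear[OF f h])
  \<comment> \<open>The nesting and the factors 1 and -1 follow the binary shape of
    \<open>L1_combine\<close>.\<close>
  have "(\<lambda>x l. 1/2 * (1 * gradient_product s s k x l + (- 1) * gradient_product f f k x l)
      + (- (1/2)) * gradient_product h h k x l) \<in> L1"
    using f h k s by (intro L1_combine gradient_product_diagonal_L1)
  moreover have "1/2 * (1 * gradient_product s s k x l + (- 1) * gradient_product f f k x l)
      + (- (1/2)) * gradient_product h h k x l = gradient_product f h k x l" for x l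
  proof -
    have ks: "gradient A g k x s = gradient A g k x f + gradient A g k x h"
      unfolding s_def[abs_def]
      using tangent_linear[OF vector_field_tangent[OF gradient_vector_field[OF k]] f h, of x 1 1] by simp
    have ss: "gradient A g s x s = gradient A g f x f + 2 * gradient A g f x h + gradient A g h x h"
      unfolding gs unfolding s_def[abs_def]
      using tangent_linear[OF vector_field_tangent[OF gradient_vector_field[OF f]] f h, of x 1 1]
        tangent_linear[OF vector_field_tangent[OF gradient_vector_field[OF h]] f h, of x 1 1]
        gradient_apply_sym[OF f h, of x]
      by simp
    show ?thesis
      using f h k s ss ks gradient_apply_sym[OF f k, of x] gradient_apply_sym[OF h k, of x]
        gradient_apply_sym[OF s k, of x] gradient_apply_sym[OF f h, of x]
      by (simp add: gradient_product_eq gs algebra_simps)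
  qed
  ultimately show ?thesis by simp
qed

text \<open>The largest submodule of the module of vector fields that is contained in \<open>L1\<close>.\<close>

definition L1_core :: "'a vector_field set" where
  "L1_core = {Z \<in> smooth_vector_fields A. \<forall>a\<in>smooth_functions A. (\<lambda>x l. a x * Z x l) \<in> L1}"

lemma L1_core_combine:
  assumes "Y \<in> L1_core" "Z \<in> L1_core" "a \<in> smooth_functions A" "b \<in> smooth_functions A"
  shows "(\<lambda>x l. a x * Y x l + b x * Z x l) \<in> L1_core"
  unfolding L1_core_def
proof (intro CollectI conjI ballI)
  show "(\<lambda>x l. a x * Y x l + b x * Z x l) \<in> smooth_vector_fields A"
    using assms by (intro vector_field_combine) (auto simp: L1_core_def)
  fix c assume c: "c \<in> smooth_functions A"
  have "(\<lambda>x l. 1 * ((\<lambda>x. c x * a x) x * Y x l) + 1 * ((\<lambda>x. c x * b x) x * Z x l)) \<in> L1"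
    by (intro L1_combine)
       (use assms c smooth_functions_mult[of c a] smooth_functions_mult[of c b] in
         \<open>simp_all add: L1_core_def del: gradient_brackets.simps\<close>)
  then show "(\<lambda>x l. c x * (a x * Y x l + b x * Z x l)) \<in> L1"
    by (simp add: distrib_left mult.assoc del: gradient_brackets.simps)
qed

lemma L1_core_sum:
  assumes "\<And>i. i \<in> I \<Longrightarrow> Z i \<in> L1_core" "\<And>i. i \<in> I \<Longrightarrow> a i \<in> smooth_functions A"
  shows "(\<lambda>x l. \<Sum>i\<in>I. a i x * Z i x l) \<in> L1_core"
proof -
  have zero: "(\<lambda>x l. 0) \<in> L1_core"
    using L1_zero L1_subset by (auto simp: L1_core_def)
  show ?thesis
    using assms
  proof (induction I rule: infinite_finite_induct)
    case (insert i I)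
    have "(\<lambda>x l. a i x * Z i x l + (\<lambda>x. 1) x * (\<Sum>i\<in>I. a i x * Z i x l)) \<in> L1_core"
      using insert.prems by (intro L1_core_combine smooth_functions_const insert.IH) auto
    then show ?case using insert.hyps by simp
  qed (simp_all add: zero)
qed

text \<open>With \<open>G = grad a\<close>, each product such as \<open>T(grad (a f), H, K)\<close>
  is \<open>a T(F, H, K) + f T(G, H, K)\<close>. Summing over the three slots gives
  \<open>3 a T(F, H, K)\<close> and three error terms. The products such as
  \<open>T(G, grad (f h), K) = f T(G, H, K) + h T(G, F, K)\<close> contain each error term twice in
  total; so they are subtracted with weight 1/2. Division by 3 produces 1/3 and -1/6.\<close>

lemma gradient_product_L1_core:
  assumes f: "f \<in> smooth_functions A" and h: "h \<in> smooth_functions A" and k: "k \<in> smooth_functions A"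
  shows "gradient_product f h k \<in> L1_core"
  unfolding L1_core_def
proof (intro CollectI conjI ballI)
  show "gradient_product f h k \<in> smooth_vector_fields A"
    using assms by (rule gradient_product_vector_field)
  fix a assume a: "a \<in> smooth_functions A"
  note T = vector_field_tangent[OF gradient_vector_field]
  have "(\<lambda>x l. 1 * (1 * (1/3 * gradient_product (\<lambda>x. a x * f x) h k x l
        + 1/3 * gradient_product (\<lambda>x. a x * h x) f k x l)
        + 1/3 * gradient_product (\<lambda>x. a x * k x) f h x l)
      + 1 * (1 * (- 1/6 * gradient_product a (\<lambda>x. f x * h x) k x l
        + - 1/6 * gradient_product a (\<lambda>x. f x * k x) h x l)
        + - 1/6 * gradient_product a (\<lambda>x. h x * k x) f x l)) \<in> L1"
    by (intro L1_combine gradient_product_L1 smooth_functions_mult a f h k)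
  moreover have "1 * (1 * (1/3 * gradient_product (\<lambda>x. a x * f x) h k x l
        + 1/3 * gradient_product (\<lambda>x. a x * h x) f k x l)
        + 1/3 * gradient_product (\<lambda>x. a x * k x) f h x l)
      + 1 * (1 * (- 1/6 * gradient_product a (\<lambda>x. f x * h x) k x l
        + - 1/6 * gradient_product a (\<lambda>x. f x * k x) h x l)
        + - 1/6 * gradient_product a (\<lambda>x. h x * k x) f x l) = a x * gradient_product f h k x l" for x l
    using gradient_apply_sym[OF f h, of x] gradient_apply_sym[OF f k, of x] gradient_apply_sym[OF h k, of x]
      gradient_apply_sym[OF a h, of x] gradient_apply_sym[OF a k, of x] gradient_apply_sym[OF a f, of x]
    by (simp add: gradient_product_eq gradient_mult smooth_functions_mult tangent_mult[OF T] a f h k)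
       (simp add: field_simps)
  ultimately show "(\<lambda>x l. a x * gradient_product f h k x l) \<in> L1"
    by (simp del: gradient_brackets.simps)
qed

section \<open>From gradients to arbitrary vector fields\<close>

lemma symmetric_product_rotate:
  assumes "X \<in> smooth_vector_fields A" "Y \<in> smooth_vector_fields A" "Z \<in> smooth_vector_fields A"
  shows "symmetric_product X Y Z = symmetric_product Y Z X"
  using form_sym[OF vector_field_tangent vector_field_tangent] assms
  by (simp add: symmetric_product_def fun_eq_iff)

lemma symmetric_product_sum_L1_core:
  assumes P: "P = (\<lambda>x l. \<Sum>i\<in>I. p i x * V i x l)"
    and p: "\<And>i. i \<in> I \<Longrightarrow> p i \<in> smooth_functions A" and V: "\<And>i. i \<in> I \<Longrightarrow> V i \<in> smooth_vector_fields A"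
    and Y: "Y \<in> smooth_vector_fields A" and Z: "Z \<in> smooth_vector_fields A"
    and core: "\<And>i. i \<in> I \<Longrightarrow> symmetric_product (V i) Y Z \<in> L1_core"
  shows "symmetric_product P Y Z \<in> L1_core"
proof -
  have "g x (P x) (W x) = (\<Sum>i\<in>I. p i x * g x (V i x) (W x))" if "W \<in> smooth_vector_fields A" for W x
    unfolding P using V that by (intro form_sum vector_field_tangent)
  then have "symmetric_product P Y Z = (\<lambda>x l. \<Sum>i\<in>I. p i x * symmetric_product (V i) Y Z x l)"
    using Y Z by (simp add: symmetric_product_def fun_eq_iff P sum.distrib sum_distrib_left
        sum_distrib_right distrib_left mult_ac)
  then show ?thesis using L1_core_sum[OF core p] by simp
qed

text \<open>Only the first slot can be expanded directly. Rotating the arguments brings each slot to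
  the front in turn: first \<open>R\<close> against two gradients, then \<open>Q\<close> against
  \<open>R\<close> and a gradient, finally \<open>P\<close> against \<open>Q\<close> and
  \<open>R\<close>.\<close>

lemma symmetric_product_L1_core:
  assumes y: "\<And>i. i \<in> I \<Longrightarrow> y i \<in> smooth_functions A"
    and p: "\<And>i. i \<in> I \<Longrightarrow> p i \<in> smooth_functions A" and P: "P = (\<lambda>x l. \<Sum>i\<in>I. p i x * gradient A g (y i) x l)"
    and q: "\<And>i. i \<in> I \<Longrightarrow> q i \<in> smooth_functions A" and Q: "Q = (\<lambda>x l. \<Sum>i\<in>I. q i x * gradient A g (y i) x l)"
    and r: "\<And>i. i \<in> I \<Longrightarrow> r i \<in> smooth_functions A" and R: "R = (\<lambda>x l. \<Sum>i\<in>I. r i x * gradient A g (y i) x l)"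
  shows "symmetric_product P Q R \<in> L1_core"
proof -
  note gr = gradient_vector_field[OF y]
  have vQ: "Q \<in> smooth_vector_fields A" unfolding Q by (intro vector_field_sum gr q)
  have vR: "R \<in> smooth_vector_fields A" unfolding R by (intro vector_field_sum gr r)
  have 1: "symmetric_product R (gradient A g (y i)) (gradient A g (y j)) \<in> L1_core" if "i \<in> I" "j \<in> I" for i j
    by (rule symmetric_product_sum_L1_core[OF R r gr gr[OF that(1)] gr[OF that(2)]])
       (use gradient_product_L1_core[OF y y[OF that(1)] y[OF that(2)]] in
         \<open>auto simp: gradient_product_def\<close>)
  have 2: "symmetric_product Q R (gradient A g (y i)) \<in> L1_core" if "i \<in> I" for i
    by (rule symmetric_product_sum_L1_core[OF Q q gr vR gr[OF that]])
       (use 1[OF that] symmetric_product_rotate[OF gr vR gr[OF that]] that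
          symmetric_product_rotate[OF vR gr[OF that] gr] in auto)
  show ?thesis
    by (rule symmetric_product_sum_L1_core[OF P p gr vQ vR])
       (use 2 symmetric_product_rotate[OF gr vQ vR] in auto)
qed

text \<open>On \<open>W\<close> the gradients of the \<open>y b\<close> are the frame dual to
  \<open>E\<close> with respect to \<open>g\<close>, because
  \<open>g(grad (y b), E c) = E c (y b)\<close>. Hence the coefficients of \<open>X\<close> are the
  \<open>g(X, E b)\<close>; off \<open>W\<close> the factor \<open>\<sigma>\<close> kills both
  sides.\<close>

lemma localised_vector_field_gradients:
  assumes fr: "coordinate_frame W W' \<sigma> y E" and X: "X \<in> smooth_vector_fields A"
  shows "(\<lambda>x l. \<sigma> x * X x l) = (\<lambda>x l. \<Sum>b\<in>B. (\<sigma> x * g x (X x) (E b x)) * gradient A g (y b) x l)"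
proof (intro ext)
  fix x l
  note F = coordinate_frameD[OF fr]
  note E = vector_field_tangent[OF F(8)] and Y = vector_field_tangent[OF gradient_vector_field[OF F(7)]]
  show "\<sigma> x * X x l = (\<Sum>b\<in>B. (\<sigma> x * g x (X x) (E b x)) * gradient A g (y b) x l)"
  proof (cases "x \<in> W")
    case True
    define w where "w = (\<lambda>l. \<Sum>b\<in>B. g x (X x) (E b x) * gradient A g (y b) x l)"
    have w: "w \<in> tangent_space A x" unfolding w_def by (rule tangent_space_sum[OF Y])
    have "g x w v = g x (X x) v" if v: "v \<in> tangent_space A x" for v
    proof -
      have "g x w v = (\<Sum>b\<in>B. g x (X x) (E b x) * g x (gradient A g (y b) x) v)"
        unfolding w_def by (rule form_sum[OF Y v])
      also have "\<dots> = (\<Sum>b\<in>B. v (y b) * g x (X x) (E b x))"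
        using form_gradient[OF F(7) v] by (simp add: mult.commute)
      also have "\<dots> = g x (X x) v"
        using form_frame_expansion[OF fr True vector_field_tangent[OF X] v] by simp
      finally show ?thesis .
    qed
    then have "w = X x" by (intro form_eqI[OF w vector_field_tangent[OF X]])
    then have "X x l = w l" by simp
    then show ?thesis by (simp add: w_def sum_distrib_left mult.assoc)
  qed (simp add: F(5))
qed

text \<open>If all \<open>g(Y, Y)\<close> vanished at \<open>x\<close>, polarisation with
  \<open>Y = E b + E c\<close> would make \<open>g\<close> zero on the frame, contrary to
  non-degeneracy. \<open>B \<noteq> {}\<close> excludes dimension zero, where every field
  vanishes.\<close>

lemma non_isotropic_vector_field:
  assumes fr: "coordinate_frame W W' \<sigma> y E" and x: "x \<in> W" and "B \<noteq> {}"
  shows "\<exists>Y\<in>smooth_vector_fields A. g x (Y x) (Y x) \<noteq> 0"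
proof (rule ccontr)
  assume "\<not> ?thesis"
  then have iso: "g x (Y x) (Y x) = 0" if "Y \<in> smooth_vector_fields A" for Y using that by blast
  note F = coordinate_frameD[OF fr]
  note E = vector_field_tangent[OF F(8)]
  have "g x (E b x) (E c x) = 0" for b c
  proof -
    define Y where "Y = (\<lambda>x f. (\<lambda>_. 1) x * E b x f + (\<lambda>_. 1) x * E c x f)"
    have Y: "Y \<in> smooth_vector_fields A"
      unfolding Y_def by (intro vector_field_combine smooth_functions_const F(8))
    have "Y x = (\<lambda>f. 1 * E b x f + 1 * E c x f)" by (simp add: Y_def)
    then have lin: "g x (Y x) v = g x (E b x) v + g x (E c x) v" if "v \<in> tangent_space A x" for v
      using form_linear[OF E E that, of 1 b 1 c] by simp
    have "0 = g x (E b x) (Y x) + g x (E c x) (Y x)"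
      using iso[OF Y] lin[OF vector_field_tangent[OF Y]] by simp
    also have "\<dots> = g x (Y x) (E b x) + g x (Y x) (E c x)"
      using form_sym[OF E vector_field_tangent[OF Y]] by simp
    also have "\<dots> = 2 * g x (E b x) (E c x)"
      using lin[OF E] iso[OF F(8)] form_sym[OF E E] by simp
    finally show ?thesis by simp
  qed
  then have "E b x = (\<lambda>f. 0)" for b
    using form_nondegenerate[OF E] form_frame_expansion[OF fr x E] by simp
  moreover obtain b where "b \<in> B" using \<open>B \<noteq> {}\<close> by blast
  ultimately show False using F(9)[OF x, of b b] by simp
qed

text \<open>With \<open>P = \<sigma>X\<close>, \<open>Q = \<sigma>Y\<close> and \<open>s = g(Q, Q)\<close>, the symmetric products of \<open>P, Q, Q\<close> and \<open>Q, Q, Q\<close>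
  are \<open>s P + 2 g(P, Q) Q\<close> and \<open>3 s Q\<close>; eliminating \<open>Q\<close> leaves \<open>s\<^sup>2 P\<close>.\<close>

lemma local_L1_core:
  "\<exists>\<theta>\<in>smooth_functions A. \<theta> x0 > 0 \<and> (\<forall>x. \<theta> x \<ge> 0) \<and>
    (\<forall>X\<in>smooth_vector_fields A. (\<lambda>x l. \<theta> x * X x l) \<in> L1_core)"
proof -
  obtain W W' \<sigma> y E where fr: "coordinate_frame W W' \<sigma> y E" and x0': "x0 \<in> W'"
    using coordinate_frame_exists by blast
  note F = coordinate_frameD[OF fr]
  have x0: "x0 \<in> W" using F(2) x0' by blast
  have loc: "(\<lambda>x. \<sigma> x * g x (X x) (E b x)) \<in> smooth_functions A" if "X \<in> smooth_vector_fields A" for X b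
    by (intro smooth_functions_mult F(3) form_smooth that F(8))
  show ?thesis
  proof (cases "B = {}")
    case True
    \<comment> \<open>In dimension zero no suitable \<open>Q\<close> exists, but the local expansion
      is an empty sum, so \<open>\<sigma> X = 0\<close>.\<close>
    have "(\<lambda>x l. \<sigma> x * X x l) \<in> L1_core" if "X \<in> smooth_vector_fields A" for X
      unfolding localised_vector_field_gradients[OF fr that] True
      using L1_core_sum[of "{}"] by simp
    then show ?thesis using F(3,6) F(4)[OF x0'] by (intro bexI[of _ \<sigma>]) auto
  next
    case False
    then obtain Y where Y: "Y \<in> smooth_vector_fields A" "g x0 (Y x0) (Y x0) \<noteq> 0"
      using non_isotropic_vector_field[OF fr x0] by blast
    define Q where "Q = (\<lambda>x l. \<sigma> x * Y x l)"
    have scale: "(\<lambda>x l. \<sigma> x * X x l) \<in> smooth_vector_fields A" if "X \<in> smooth_vector_fields A" for X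
      using vector_field_combine[OF that that F(3) smooth_functions_const[of 0]] by simp
    have vQ: "Q \<in> smooth_vector_fields A" unfolding Q_def by (rule scale[OF Y(1)])
    define s where "s x = g x (Q x) (Q x)" for x
    have s: "s \<in> smooth_functions A" unfolding s_def by (rule form_smooth[OF vQ vQ])
    have "Q x0 = Y x0" using F(4)[OF x0'] by (simp add: Q_def)
    then have s0: "s x0 \<noteq> 0" using Y(2) by (simp add: s_def)
    have "(\<lambda>x l. (s x * s x * \<sigma> x) * X x l) \<in> L1_core" if X: "X \<in> smooth_vector_fields A" for X
    proof -
      define P where "P = (\<lambda>x l. \<sigma> x * X x l)"
      have vP: "P \<in> smooth_vector_fields A" unfolding P_def by (rule scale[OF X])
      note Pg = localised_vector_field_gradients[OF fr X, folded P_def]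
        and Qg = localised_vector_field_gradients[OF fr Y(1), folded Q_def]
      have PQQ: "symmetric_product P Q Q \<in> L1_core"
        by (rule symmetric_product_L1_core[OF F(7) loc[OF X] Pg loc[OF Y(1)] Qg loc[OF Y(1)] Qg])
      have QQQ: "symmetric_product Q Q Q \<in> L1_core"
        by (rule symmetric_product_L1_core[OF F(7) loc[OF Y(1)] Qg loc[OF Y(1)] Qg loc[OF Y(1)] Qg])
      have "(\<lambda>x l. s x * symmetric_product P Q Q x l
          + (- (2/3) * g x (P x) (Q x)) * symmetric_product Q Q Q x l) \<in> L1_core"
        by (intro L1_core_combine PQQ QQQ s smooth_functions_mult smooth_functions_const form_smooth vP vQ)
      moreover have "s x * symmetric_product P Q Q x l
          + (- (2/3) * g x (P x) (Q x)) * symmetric_product Q Q Q x l = (s x * s x * \<sigma> x) * X x l" for x l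
      proof -
        have "P x l = \<sigma> x * X x l" by (simp add: P_def)
        then show ?thesis by (simp add: symmetric_product_def s_def[symmetric] algebra_simps)
      qed
      ultimately show ?thesis by simp
    qed
    moreover have "(\<lambda>x. s x * s x * \<sigma> x) \<in> smooth_functions A"
      by (intro smooth_functions_mult s F(3))
    moreover have "s x0 * s x0 * \<sigma> x0 > 0" using s0 F(4)[OF x0'] by (auto simp: zero_less_mult_iff linorder_neq_iff)
    \<comment> \<open>Squaring \<open>s\<close> gives a sign to the weight although \<open>g\<close>
      may be indefinite and \<open>s\<close> may change sign in \<open>W\<close>.\<close>
    moreover have "s x * s x * \<sigma> x \<ge> 0" for x using F(6)[of x] by simp
    ultimately show ?thesis by (intro bexI[of _ "\<lambda>x. s x * s x * \<sigma> x"]) auto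
  qed
qed

text \<open>Finitely many weights suffice by compactness, and their sum \<open>S\<close> is positive
  since none is negative. Normalising them amounts to the smooth coefficient
  \<open>inverse (S x)\<close>, which is admissible because \<open>L1_core\<close> is a
  module.\<close>

lemma L1_eq_vector_fields:
  assumes "compact (UNIV :: 'a set)"
  shows "L1 = smooth_vector_fields A"
proof
  have "\<forall>i. \<exists>\<theta>. \<theta> \<in> smooth_functions A \<and> \<theta> i > 0 \<and> (\<forall>x. \<theta> x \<ge> 0) \<and>
      (\<forall>X\<in>smooth_vector_fields A. (\<lambda>x l. \<theta> x * X x l) \<in> L1_core)"
    using local_L1_core unfolding Bex_def by (rule allI)
  from choice[OF this] obtain \<theta> where "\<forall>i. \<theta> i \<in> smooth_functions A \<and> \<theta> i i > 0 \<and> (\<forall>x. \<theta> i x \<ge> 0) \<and>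
      (\<forall>X\<in>smooth_vector_fields A. (\<lambda>x l. \<theta> i x * X x l) \<in> L1_core)" ..
  then have \<theta>: "\<theta> i \<in> smooth_functions A" "\<theta> i i > 0" "\<theta> i x \<ge> 0"
    "X \<in> smooth_vector_fields A \<Longrightarrow> (\<lambda>x l. \<theta> i x * X x l) \<in> L1_core" for i x X
    by simp_all
  have op: "open {x. \<theta> i x > 0}" for i
    using open_Collect_less[of "\<lambda>_. 0" "\<theta> i"] smooth_functions_continuous[OF \<theta>(1)] by simp
  have "UNIV \<subseteq> (\<Union>i\<in>UNIV. {x. \<theta> i x > 0})" using \<theta>(2) by blast
  then obtain I where I: "finite I" "UNIV \<subseteq> (\<Union>i\<in>I. {x. \<theta> i x > 0})"
    by (rule compactE_image[OF assms, of UNIV "\<lambda>i. {x. \<theta> i x > 0}", OF op])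
  define S where "S x = (\<Sum>i\<in>I. \<theta> i x)" for x
  have "S x > 0" for x
  proof -
    obtain i where "i \<in> I" "\<theta> i x > 0" using I(2) by blast
    then show ?thesis unfolding S_def using I(1) \<theta>(3) by (intro sum_pos2[of I i]) auto
  qed
  then have S0: "S x \<noteq> 0" for x by (metis less_irrefl)
  have S: "(\<lambda>x. inverse (S x)) \<in> smooth_functions A"
    using S0 unfolding S_def by (intro smooth_functions_inverse smooth_functions_sum \<theta>(1)) auto
  show "smooth_vector_fields A \<subseteq> L1"
  proof
    fix X assume X: "X \<in> smooth_vector_fields A"
    have "(\<lambda>x l. \<Sum>i\<in>I. inverse (S x) * (\<theta> i x * X x l)) \<in> L1_core"
      by (rule L1_core_sum[where Z = "\<lambda>i x l. \<theta> i x * X x l" and a = "\<lambda>i x. inverse (S x)"])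
         (use \<theta>(4)[OF X] S in auto)
    moreover have "(\<Sum>i\<in>I. inverse (S x) * (\<theta> i x * X x l)) = X x l" for x l
    proof -
      have "(\<Sum>i\<in>I. inverse (S x) * (\<theta> i x * X x l)) = inverse (S x) * (S x * X x l)"
        by (simp add: S_def sum_distrib_left sum_distrib_right mult.assoc)
      then show ?thesis using S0[of x] by simp
    qed
    ultimately have "X \<in> L1_core" by simp
    then have "\<forall>a\<in>smooth_functions A. (\<lambda>x l. a x * X x l) \<in> L1" by (simp add: L1_core_def)
    from bspec[OF this smooth_functions_const[of 1]] show "X \<in> L1" by (simp del: gradient_brackets.simps)
  qed
qed (rule L1_subset)

end

theorem theorem1:
  fixes A :: "('a::t2_space, 'e::real_inner) chart set"
    and g :: "'a \<Rightarrow> 'a tangent_vector \<Rightarrow> 'a tangent_vector \<Rightarrow> real"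
  assumes "smooth_atlas A"
    and "compact (UNIV :: 'a set)"
    and "smooth_nondegenerate_form A g"
  shows "\<exists>m::nat. gradient_brackets A g m = smooth_vector_fields A"
proof -
  have "\<exists>S :: 'e set. finite S \<and> span S = UNIV"
    using assms(1) by (simp add: smooth_atlas_def)
  then obtain S :: "'e set" where "finite S" "span S = UNIV" by blast
  then obtain B :: "'e set" where "orthonormal_basis B" by (rule obtain_orthonormal_basis)
  then have "form_manifold B A g"
    using assms(1,3) by (simp add: form_manifold_def form_manifold_axioms_def smooth_manifold_def
        smooth_manifold_axioms_def)
  from form_manifold.L1_eq_vector_fields[OF this assms(2)] show ?thesis by blast
qed

end
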